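(* Let $M$ be an almost hyper-Hermitian manifold of dimension $4n$, $n\ge 2$, with almost complex structures $I,J,K$. (i) If $\nabla\omega_I\in\mathcal W_3+\mathcal W_4$ and $\nabla\omega_J\in\mathcal C$, then $\nabla\omega_K\in\mathcal C$, where $\mathcal C$ is any Gray-Hervella class of almost Hermitian structures. (ii) If $\nabla\omega_I,\nabla\omega_J\in\mathcal C+\mathcal W_3+\mathcal W_4$, then $\nabla\omega_K\in\mathcal C+\mathcal W_3+\mathcal W_4$, for $\mathcal C=\mathcal W_1,\mathcal W_2$. (iii) If $\nabla\omega_I,\nabla\omega_J\in\mathcal W_1+\mathcal W_2$, then $\nabla\omega_K\in\mathcal W_3+\mathcal W_4$. (iv) If $\nabla\omega_I,\nabla\omega_J\in\mathcal W_1+\mathcal W_2+\mathcal W_4$ and $\nabla\omega_K\in\mathcal C+\mathcal W_3+\mathcal W_4$, for $\mathcal C=\mathcal W_1$ or $\mathcal C=\mathcal W_2$, then $\nabla\omega_K\in\mathcal W_3+\mathcal W_4$. Moreover, if $M$ is eight-dimensional, we also have (v) If $\nabla\omega_I,\nabla\omega_J\in\mathcal W_1+\mathcal W_2+\mathcal W_3$ and $\nabla\omega_K\in\mathcal W_1+\mathcal W_3+\mathcal W_4$, then $\nabla\omega_K\in\mathcal W_3+\mathcal W_4$.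
   Context: An almost hyper-Hermitian manifold is a smooth manifold $M$ of dimension $4n$, $n\ge2$, with a Riemannian metric $\langle\cdot,\cdot\rangle$ and global endomorphism fields $I,J,K$ of $TM$ satisfying $I^2=J^2=-1$, $K=IJ=-JI$ and $\langle AX,AY\rangle=\langle X,Y\rangle$ for $A=I,J,K$. Put $\omega_A(X,Y)=\langle X,AY\rangle$, let $\nabla$ be the Levi-Civita connection, and regard $\nabla\omega_A$ as the $(0,3)$-tensor $(X,Y,Z)\mapsto(\nabla_X\omega_A)(Y,Z)$. Gray-Hervella classes: for $A\in\{I,J,K\}$, $\nabla\omega_A$ takes values in $\mathcal W^A=\{b\in T^*M\otimes\Lambda^2T^*M: b(X,AY,AZ)=-b(X,Y,Z)\}$, and $\mathcal W^A=\mathcal W_1\oplus\mathcal W_2\oplus\mathcal W_3\oplus\mathcal W_4$ (orthogonal), where, with $\{e_i\}$ an orthonormal basis, $\mathcal W_1$: $b(X,X,Z)=0$ for all $X,Z$; $\mathcal W_2$: $b(X,Y,Z)+b(Y,Z,X)+b(Z,X,Y)=0$; $\mathcal W_3$: $b(AX,AY,Z)=b(X,Y,Z)$ and $\sum_i b(e_i,e_i,Z)=0$; $\mathcal W_4$: $b(X,Y,Z)=\langle X,Y\rangle\beta(Z)-\langle X,Z\rangle\beta(Y)-\langle X,AY\rangle\beta(AZ)+\langle X,AZ\rangle\beta(AY)$ for some one-form $\beta$. A Gray-Hervella class is one of the 16 sums of a subset of $\{\mathcal W_1,\dots,\mathcal W_4\}$ (including $\{0\}$). The statement $\nabla\omega_A\in\mathcal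 C$ means that at every point $\nabla\omega_A$ lies in the indicated sum of the spaces $\mathcal W_i$ defined using $A$ itself. *)

theory Defs
  imports "HOL-Analysis.Analysis"
begin

section \<open>Smooth manifolds\<close>

text \<open>
  \<open>Ck_on k f S\<close> is meant for open \<open>S\<close>: all iterated directional derivatives of \<open>f\<close> up to order
  \<open>k\<close> exist on \<open>S\<close> (the ones of order below \<open>k\<close> being differentiable) and those of order \<open>k\<close> are
  continuous.
\<close>

primrec Ck_on :: "nat \<Rightarrow> ('v::euclidean_space \<Rightarrow> 'w::real_normed_vector) \<Rightarrow> 'v set \<Rightarrow> bool" where
  "Ck_on 0 f S \<longleftrightarrow> continuous_on S f"
| "Ck_on (Suc k) f S \<longleftrightarrow>
     (\<forall>x\<in>S. f differentiable (at x)) \<and> (\<forall>v. Ck_on k (\<lambda>x. frechet_derivative f (at x) v) S)"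

definition smooth_on :: "('v::euclidean_space \<Rightarrow> 'w::real_normed_vector) \<Rightarrow> 'v set \<Rightarrow> bool" where
  "smooth_on f S \<longleftrightarrow> (\<forall>k. Ck_on k f S)"

text \<open>A chart is an open set of the manifold with a coordinate map to the model space \<open>'v\<close>.\<close>

type_synonym ('a, 'v) chart = "'a set \<times> ('a \<Rightarrow> 'v)"

definition chart_dom :: "('a, 'v) chart \<Rightarrow> 'a set" where
  "chart_dom c = fst c"

definition chart_map :: "('a, 'v) chart \<Rightarrow> 'a \<Rightarrow> 'v" where
  "chart_map c = snd c"

definition chart_inv :: "('a, 'v) chart \<Rightarrow> 'v \<Rightarrow> 'a" where
  "chart_inv c = inv_into (chart_dom c) (chart_map c)"

definition smooth_manifold :: "'a topology \<Rightarrow> ('a, 'v::euclidean_space) chart set \<Rightarrow> bool" where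
  "smooth_manifold X \<A> \<longleftrightarrow>
     Hausdorff_space X \<and> second_countable X \<and>
     (\<Union>c\<in>\<A>. chart_dom c) = topspace X \<and>
     (\<forall>c\<in>\<A>. openin X (chart_dom c) \<and> open (chart_map c ` chart_dom c) \<and>
        homeomorphic_map (subtopology X (chart_dom c))
          (top_of_set (chart_map c ` chart_dom c)) (chart_map c)) \<and>
     (\<forall>c\<in>\<A>. \<forall>d\<in>\<A>.
        smooth_on (chart_map d \<circ> chart_inv c) (chart_map c ` (chart_dom c \<inter> chart_dom d)))"


section \<open>Tensor fields\<close>

text \<open>
  A tensor field is given by its components in the charts of the atlas: for a chart \<open>c\<close> and a point
  \<open>p\<close> of its domain, a multilinear map on the model space \<open>'v\<close>, whose vectors \<open>u\<close> stand for the
  tangent vectors \<open>\<Sum>\<^sub>i u\<^sup>i \<partial>/\<partial>x\<^sup>i\<close> of \<open>M\<close> at \<open>p\<close> (\<open>x\<^sup>i\<close> being the coordinates of \<open>c\<close>).  Components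
  in different charts are related through the differential \<open>tangent_change c d p\<close> of the coordinate
  change.  Values at points outside the domain of \<open>c\<close>, or for \<open>c\<close> outside the atlas, are junk.
  The inner product of \<open>'v\<close> itself plays no role.
\<close>

definition tangent_change ::
  "('a, 'v::euclidean_space) chart \<Rightarrow> ('a, 'v) chart \<Rightarrow> 'a \<Rightarrow> 'v \<Rightarrow> 'v" where
  "tangent_change c d p = frechet_derivative (chart_map d \<circ> chart_inv c) (at (chart_map c p))"

text \<open>Derivative at \<open>p\<close> of a real function \<open>f\<close> on \<open>M\<close> along the vector with components \<open>u\<close> in \<open>c\<close>.\<close>

definition chart_deriv :: "('a, 'v::euclidean_space) chart \<Rightarrow> ('a \<Rightarrow> real) \<Rightarrow> 'a \<Rightarrow> 'v \<Rightarrow> real" where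
  "chart_deriv c f p = frechet_derivative (f \<circ> chart_inv c) (at (chart_map c p))"

type_synonym ('a, 'v) bilinear_field = "('a, 'v) chart \<Rightarrow> 'a \<Rightarrow> 'v \<Rightarrow> 'v \<Rightarrow> real"
type_synonym ('a, 'v) endo_field = "('a, 'v) chart \<Rightarrow> 'a \<Rightarrow> 'v \<Rightarrow> 'v"

definition riemannian_metric ::
  "('a, 'v::euclidean_space) chart set \<Rightarrow> ('a, 'v) bilinear_field \<Rightarrow> bool" where
  "riemannian_metric \<A> g \<longleftrightarrow>
     (\<forall>c\<in>\<A>. \<forall>p\<in>chart_dom c. bilinear (g c p) \<and>
        (\<forall>u v. g c p u v = g c p v u) \<and> (\<forall>u. u \<noteq> 0 \<longrightarrow> g c p u u > 0)) \<and>
     (\<forall>c\<in>\<A>. \<forall>u v. smooth_on (\<lambda>x. g c (chart_inv c x) u v) (chart_map c ` chart_dom c)) \<and>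
     (\<forall>c\<in>\<A>. \<forall>d\<in>\<A>. \<forall>p\<in>chart_dom c \<inter> chart_dom d. \<forall>u v.
        g d p (tangent_change c d p u) (tangent_change c d p v) = g c p u v)"

definition endomorphism_field ::
  "('a, 'v::euclidean_space) chart set \<Rightarrow> ('a, 'v) endo_field \<Rightarrow> bool" where
  "endomorphism_field \<A> E \<longleftrightarrow>
     (\<forall>c\<in>\<A>. \<forall>p\<in>chart_dom c. linear (E c p)) \<and>
     (\<forall>c\<in>\<A>. \<forall>u. smooth_on (\<lambda>x. E c (chart_inv c x) u) (chart_map c ` chart_dom c)) \<and>
     (\<forall>c\<in>\<A>. \<forall>d\<in>\<A>. \<forall>p\<in>chart_dom c \<inter> chart_dom d. \<forall>u.
        E d p (tangent_change c d p u) = tangent_change c d p (E c p u))"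


section \<open>Almost hyper-Hermitian manifolds\<close>

text \<open>The dimension \<open>DIM('v)\<close> is left free here; it is \<open>4 * n\<close> with \<open>n \<ge> 2\<close> in the theorem.\<close>

definition almost_hyper_hermitian ::
  "'a topology \<Rightarrow> ('a, 'v::euclidean_space) chart set \<Rightarrow> ('a, 'v) bilinear_field \<Rightarrow>
   ('a, 'v) endo_field \<Rightarrow> ('a, 'v) endo_field \<Rightarrow> ('a, 'v) endo_field \<Rightarrow> bool" where
  "almost_hyper_hermitian X \<A> g I J K \<longleftrightarrow>
     smooth_manifold X \<A> \<and> riemannian_metric \<A> g \<and>
     endomorphism_field \<A> I \<and> endomorphism_field \<A> J \<and> endomorphism_field \<A> K \<and>
     (\<forall>c\<in>\<A>. \<forall>p\<in>chart_dom c.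
        (\<forall>u. I c p (I c p u) = - u) \<and>
        (\<forall>u. J c p (J c p u) = - u) \<and>
        (\<forall>u. K c p u = I c p (J c p u)) \<and>
        (\<forall>u. K c p u = - J c p (I c p u)) \<and>
        (\<forall>E\<in>{I, J, K}. \<forall>u v. g c p (E c p u) (E c p v) = g c p u v))"

definition fundamental_form ::
  "('a, 'v) bilinear_field \<Rightarrow> ('a, 'v) endo_field \<Rightarrow> ('a, 'v) bilinear_field" where
  "fundamental_form g E = (\<lambda>c p u v. g c p u (E c p v))"

text \<open>
  \<open>\<Gamma>\<close> is the array of Christoffel symbols at \<open>p\<close> of a torsion-free metric connection:
  \<open>\<Gamma> u v\<close> is \<open>\<nabla>\<^sub>U V\<close> at \<open>p\<close> for the fields \<open>U\<close>, \<open>V\<close> on the domain of \<open>c\<close> with constant components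
  \<open>u\<close>, \<open>v\<close>.  As \<open>[U, V] = 0\<close>, vanishing torsion is symmetry of \<open>\<Gamma>\<close>.
\<close>

definition is_levi_civita ::
  "('a, 'v::euclidean_space) bilinear_field \<Rightarrow> ('a, 'v) chart \<Rightarrow> 'a \<Rightarrow> ('v \<Rightarrow> 'v \<Rightarrow> 'v) \<Rightarrow> bool" where
  "is_levi_civita g c p \<Gamma> \<longleftrightarrow>
     bilinear \<Gamma> \<and> (\<forall>u v. \<Gamma> u v = \<Gamma> v u) \<and>
     (\<forall>u v w. chart_deriv c (\<lambda>q. g c q v w) p u = g c p (\<Gamma> u v) w + g c p v (\<Gamma> u w))"

definition levi_civita ::
  "('a, 'v::euclidean_space) bilinear_field \<Rightarrow> ('a, 'v) chart \<Rightarrow> 'a \<Rightarrow> 'v \<Rightarrow> 'v \<Rightarrow> 'v" where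
  "levi_civita g c p = (THE \<Gamma>. is_levi_civita g c p \<Gamma>)"

text \<open>\<open>(\<nabla>\<^sub>u \<omega>)(v, w) = u(\<omega>(v, w)) - \<omega>(\<nabla>\<^sub>u v, w) - \<omega>(v, \<nabla>\<^sub>u w)\<close>, with \<open>v\<close>, \<open>w\<close> extended constantly.\<close>

definition nabla ::
  "('a, 'v::euclidean_space) bilinear_field \<Rightarrow> ('a, 'v) bilinear_field \<Rightarrow>
   ('a, 'v) chart \<Rightarrow> 'a \<Rightarrow> 'v \<Rightarrow> 'v \<Rightarrow> 'v \<Rightarrow> real" where
  "nabla g \<omega> c p u v w = chart_deriv c (\<lambda>q. \<omega> c q v w) p u
     - \<omega> c p (levi_civita g c p u v) w - \<omega> c p v (levi_civita g c p u w)"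


section \<open>Gray-Hervella classes\<close>

text \<open>
  Here \<open>h\<close> is an inner product on \<open>'v\<close> (the metric at a point, read in a chart) and \<open>A\<close> an
  orthogonal complex structure on \<open>('v, h)\<close>.
\<close>

definition GH_space ::
  "('v::euclidean_space \<Rightarrow> 'v) \<Rightarrow> ('v \<Rightarrow> 'v \<Rightarrow> 'v \<Rightarrow> real) set" where
  "GH_space A = {b.
     (\<forall>y z. linear (\<lambda>x. b x y z)) \<and> (\<forall>x z. linear (\<lambda>y. b x y z)) \<and> (\<forall>x y. linear (\<lambda>z. b x y z)) \<and>
     (\<forall>x y z. b x y z = - b x z y) \<and>
     (\<forall>x y z. b x (A y) (A z) = - b x y z)}"

definition orthonormal_basis_for :: "('v::euclidean_space \<Rightarrow> 'v \<Rightarrow> real) \<Rightarrow> 'v set \<Rightarrow> bool" where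
  "orthonormal_basis_for h B \<longleftrightarrow>
     finite B \<and> span B = UNIV \<and> (\<forall>e\<in>B. \<forall>f\<in>B. h e f = (if e = f then 1 else 0))"

datatype GH_index = W1 | W2 | W3 | W4

primrec GH_summand ::
  "('v::euclidean_space \<Rightarrow> 'v \<Rightarrow> real) \<Rightarrow> ('v \<Rightarrow> 'v) \<Rightarrow> GH_index \<Rightarrow> ('v \<Rightarrow> 'v \<Rightarrow> 'v \<Rightarrow> real) set" where
  "GH_summand h A W1 = {b \<in> GH_space A. \<forall>x z. b x x z = 0}"
| "GH_summand h A W2 = {b \<in> GH_space A. \<forall>x y z. b x y z + b y z x + b z x y = 0}"
| "GH_summand h A W3 = {b \<in> GH_space A.
     (\<forall>x y z. b (A x) (A y) z = b x y z) \<and>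
     (\<forall>B z. orthonormal_basis_for h B \<longrightarrow> (\<Sum>e\<in>B. b e e z) = 0)}"
| "GH_summand h A W4 = {b \<in> GH_space A. \<exists>\<beta>. linear \<beta> \<and>
     (\<forall>x y z. b x y z =
        h x y * \<beta> z - h x z * \<beta> y - h x (A y) * \<beta> (A z) + h x (A z) * \<beta> (A y))}"

text \<open>The 16 Gray-Hervella classes correspond to the sets \<open>S\<close>; the empty sum is \<open>{0}\<close>.\<close>

definition GH_class ::
  "('v::euclidean_space \<Rightarrow> 'v \<Rightarrow> real) \<Rightarrow> ('v \<Rightarrow> 'v) \<Rightarrow> GH_index set \<Rightarrow>
   ('v \<Rightarrow> 'v \<Rightarrow> 'v \<Rightarrow> real) set" where
  "GH_class h A S = {b. \<exists>w. (\<forall>i\<in>S. w i \<in> GH_summand h A i) \<and> b = (\<lambda>x y z. \<Sum>i\<in>S. w i x y z)}"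

text \<open>\<open>\<nabla>\<omega>\<^sub>E\<close> lies at every point in the sum, taken with respect to \<open>E\<close> itself, of the spaces in \<open>S\<close>.\<close>

definition nabla_form_in ::
  "('a, 'v::euclidean_space) chart set \<Rightarrow> ('a, 'v) bilinear_field \<Rightarrow> ('a, 'v) endo_field \<Rightarrow>
   GH_index set \<Rightarrow> bool" where
  "nabla_form_in \<A> g E S \<longleftrightarrow>
     (\<forall>c\<in>\<A>. \<forall>p\<in>chart_dom c. nabla g (fundamental_form g E) c p \<in> GH_class (g c p) (E c p) S)"


section \<open>Existence of the Levi-Civita connection and of orthonormal bases\<close>

lemma finite_GH_index: "finite (S :: GH_index set)"
proof (rule finite_subset)
  show "S \<subseteq> {W1, W2, W3, W4}" using GH_index.exhaust by blast
qed simp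

lemma inner_product_representation:
  fixes h :: "'v::euclidean_space \<Rightarrow> 'v \<Rightarrow> real"
  assumes "bilinear h" and pos: "\<And>u. u \<noteq> 0 \<Longrightarrow> h u u > 0" and l: "linear l"
  shows "\<exists>u. \<forall>w. h u w = l w"
proof -
  define T where "T u = (\<Sum>b\<in>Basis. h u b *\<^sub>R b)" for u
  have lin1: "linear (\<lambda>u. h u w)" and lin2: "linear (\<lambda>w. h u w)" for u w
    using assms(1) by (auto simp: bilinear_def)
  have T: "T u \<bullet> w = h u w" for u w
  proof -
    have "h u w = h u (\<Sum>b\<in>Basis. (w \<bullet> b) *\<^sub>R b)" by (simp add: euclidean_representation)
    also have "\<dots> = (\<Sum>b\<in>Basis. (w \<bullet> b) * h u b)"
      using lin2 by (simp add: linear_sum linear_cmul)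
    also have "\<dots> = T u \<bullet> w"
      by (simp add: T_def inner_sum_left inner_commute[of w] mult.commute)
    finally show ?thesis by simp
  qed
  have "linear T"
    unfolding T_def
    by (intro linear_compose_sum ballI linear_compose[OF lin1, unfolded o_def])
       (auto intro: linearI simp: algebra_simps)
  moreover have "u = 0" if "T u = 0" for u
    using T[of u u] pos[of u] that by auto
  ultimately have "surj T"
    by (simp add: linear_injective_0 linear_injective_imp_surjective)
  then obtain u where u: "T u = (\<Sum>b\<in>Basis. l b *\<^sub>R b)" by (metis surjD)
  have "h u w = l w" for w
  proof -
    have "h u w = (\<Sum>b\<in>Basis. l b * (b \<bullet> w))" by (simp add: T[symmetric] u inner_sum_left)
    also have "\<dots> = l (\<Sum>b\<in>Basis. (w \<bullet> b) *\<^sub>R b)"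
      using l by (simp add: linear_sum linear_cmul inner_commute mult.commute)
    finally show ?thesis by (simp add: euclidean_representation)
  qed
  then show ?thesis by blast
qed

theorem levi_civita_unique_exists:
  assumes M: "smooth_manifold X \<A>" and g: "riemannian_metric \<A> g"
    and c: "c \<in> \<A>" and p: "p \<in> chart_dom c"
  shows "\<exists>!\<Gamma>. is_levi_civita g c p \<Gamma>"
proof -
  let ?S = "chart_map c ` chart_dom c" and ?x = "chart_map c p"
  define h where "h = g c p"
  define D where "D u v w = chart_deriv c (\<lambda>q. g c q v w) p u" for u v w
  have gc: "bilinear (g c q)" "g c q u v = g c q v u" if "q \<in> chart_dom c" for q u v
    using g c that by (auto simp: riemannian_metric_def)
  have hb: "bilinear h" and hs: "\<And>u v. h u v = h v u" and hp: "\<And>u. u \<noteq> 0 \<Longrightarrow> h u u > 0"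
    using g c p by (auto simp: h_def riemannian_metric_def)
  have op: "open ?S" and x: "?x \<in> ?S" using M c p by (auto simp: smooth_manifold_def)
  have inv: "chart_inv c x \<in> chart_dom c" if "x \<in> ?S" for x
    using that by (simp add: chart_inv_def inv_into_into)
  have diff: "(\<lambda>x. g c (chart_inv c x) v w) differentiable (at ?x)" for v w
  proof -
    have "Ck_on (Suc 0) (\<lambda>x. g c (chart_inv c x) v w) ?S"
      using g c unfolding riemannian_metric_def smooth_on_def by blast
    then show ?thesis using p by simp
  qed
  have D: "((\<lambda>x. g c (chart_inv c x) v w) has_derivative (\<lambda>u. D u v w)) (at ?x)" for v w
    using diff[of v w] by (simp add: D_def chart_deriv_def o_def frechet_derivative_works[symmetric])
  have D1: "linear (\<lambda>u. D u v w)" for v w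
    using D has_derivative_linear by blast
  have Ds: "D u v w = D u w v" for u v w
  proof -
    have "((\<lambda>x. g c (chart_inv c x) w v) has_derivative (\<lambda>u. D u v w)) (at ?x)"
      by (rule has_derivative_transform_within_open[OF D op x]) (use gc inv in auto)
    from has_derivative_unique[OF this D] show ?thesis by metis
  qed
  have Dadd: "D u (v + v') w = D u v w + D u v' w" for u v v' w
  proof -
    have "((\<lambda>x. g c (chart_inv c x) (v + v') w) has_derivative (\<lambda>u. D u v w + D u v' w)) (at ?x)"
      by (rule has_derivative_transform_within_open[OF has_derivative_add[OF D D] op x])
         (use gc inv in \<open>auto simp: bilinear_ladd\<close>)
    from has_derivative_unique[OF this D] show ?thesis by metis
  qed
  have Dscale: "D u (r *\<^sub>R v) w = r * D u v w" for u r v w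
  proof -
    have "((\<lambda>x. g c (chart_inv c x) (r *\<^sub>R v) w) has_derivative (\<lambda>u. r *\<^sub>R D u v w)) (at ?x)"
      by (rule has_derivative_transform_within_open[OF has_derivative_scaleR_right[OF D] op x])
         (use gc inv in \<open>auto simp: bilinear_lmul\<close>)
    from has_derivative_unique[OF this D] show ?thesis by (metis real_scaleR_def)
  qed
  have D2: "linear (\<lambda>v. D u v w)" for u w
    by (rule linearI) (simp_all add: Dadd Dscale)
  have D3: "linear (\<lambda>w. D u v w)" for u v
    using D2[of u v] Ds by simp
  have is_lc: "is_levi_civita g c p \<Gamma> \<longleftrightarrow> bilinear \<Gamma> \<and> (\<forall>u v. \<Gamma> u v = \<Gamma> v u) \<and>
      (\<forall>u v w. D u v w = h (\<Gamma> u v) w + h v (\<Gamma> u w))" for \<Gamma>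
    by (simp add: is_levi_civita_def D_def h_def)
  define l where "l u v w = (D u v w + D v u w - D w u v) / 2" for u v w
  have hinj: "a = b" if "\<And>w. h a w = h b w" for a b
    using hp[of "a - b"] that[of "a - b"] hb by (auto simp: bilinear_lsub)
  have "linear (l u v)" for u v
    unfolding l_def
    by (rule linearI)
       (simp_all add: linear_add[OF D1] linear_add[OF D3] linear_cmul[OF D1] linear_cmul[OF D3]
          field_simps)
  then have "\<forall>u v. \<exists>a. \<forall>w. h a w = l u v w"
    using inner_product_representation[OF hb hp] by blast
  then obtain \<Gamma> where \<Gamma>: "\<And>u v w. h (\<Gamma> u v) w = l u v w" by metis
  show ?thesis
  proof (rule ex1I)
    have "bilinear \<Gamma>"
      unfolding bilinear_def
      by (intro conjI allI linearI; rule hinj)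
         (simp_all add: bilinear_ladd[OF hb] bilinear_lmul[OF hb] \<Gamma> l_def
            linear_add[OF D1] linear_add[OF D2] linear_add[OF D3]
            linear_cmul[OF D1] linear_cmul[OF D2] linear_cmul[OF D3] field_simps)
    moreover have "\<Gamma> u v = \<Gamma> v u" for u v
      by (rule hinj) (simp add: \<Gamma> l_def Ds[of _ u v])
    moreover have "D u v w = h (\<Gamma> u v) w + h v (\<Gamma> u w)" for u v w
      using hs[of v "\<Gamma> u w"] Ds[of u v w] Ds[of v u w] Ds[of w u v]
      by (simp add: \<Gamma> l_def field_simps)
    ultimately show "is_levi_civita g c p \<Gamma>" unfolding is_lc by blast
  next
    fix \<Gamma>' assume "is_levi_civita g c p \<Gamma>'"
    then have s: "\<And>u v. \<Gamma>' u v = \<Gamma>' v u"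
      and m: "\<And>u v w. D u v w = h (\<Gamma>' u v) w + h v (\<Gamma>' u w)"
      unfolding is_lc by blast+
    have "h (\<Gamma>' u v) w = l u v w" for u v w
      using m[of u v w] m[of v u w] m[of w u v] s[of u v] s[of u w] s[of v w]
        hs[of u "\<Gamma>' v w"] hs[of v "\<Gamma>' u w"] hs[of u "\<Gamma>' w v"]
      by (simp add: l_def)
    then show "\<Gamma>' = \<Gamma>" by (intro ext hinj) (simp add: \<Gamma>)
  qed
qed

lemma is_levi_civita_levi_civita:
  assumes "smooth_manifold X \<A>" and "riemannian_metric \<A> g" and "c \<in> \<A>" and "p \<in> chart_dom c"
  shows "is_levi_civita g c p (levi_civita g c p)"
  unfolding levi_civita_def by (rule theI'[OF levi_civita_unique_exists[OF assms]])

lemma orthonormal_basis_for_exists: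
  fixes h :: "'v::euclidean_space \<Rightarrow> 'v \<Rightarrow> real"
  assumes h: "bilinear h" and sym: "\<And>u v. h u v = h v u" and pos: "\<And>u. u \<noteq> 0 \<Longrightarrow> h u u > 0"
  shows "\<exists>B. orthonormal_basis_for h B"
proof -
  define on where "on B \<longleftrightarrow> finite B \<and> (\<forall>e\<in>B. \<forall>f\<in>B. h e f = (if e = f then 1 else 0))" for B
  have lin1: "linear (\<lambda>u. h u w)" for w
    using h by (auto simp: bilinear_def)
  have coeff: "h (\<Sum>e\<in>B. a e *\<^sub>R e) f = a f" if "on B" "f \<in> B" for a B f
  proof -
    have "h (\<Sum>e\<in>B. a e *\<^sub>R e) f = (\<Sum>e\<in>B. a e * h e f)"
      by (simp add: linear_sum[OF lin1] linear_cmul[OF lin1])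
    also have "\<dots> = (\<Sum>e\<in>B. if e = f then a e else 0)"
      by (rule sum.cong) (use that in \<open>auto simp: on_def\<close>)
    finally show ?thesis using that by (simp add: on_def)
  qed
  have card: "card B \<le> DIM('v)" if B: "on B" for B
  proof -
    have "independent B"
    proof (rule independent_if_scalars_zero)
      show "finite B" using B by (simp add: on_def)
      fix a f assume "(\<Sum>e\<in>B. a e *\<^sub>R e) = 0" "f \<in> B"
      then show "a f = 0" using coeff[OF B, of f a] by (simp add: bilinear_lzero[OF h])
    qed
    then show ?thesis by (rule independent_bound[THEN conjunct2])
  qed
  have "\<exists>B. on B \<and> (\<forall>C. on C \<longrightarrow> card C \<le> card B)"
    by (rule ex_has_greatest_nat[of on "{}" card "Suc DIM('v)"])
       (use card in \<open>auto simp: on_def less_Suc_eq_le\<close>)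
  then obtain B where B: "on B" and max: "\<And>C. on C \<Longrightarrow> card C \<le> card B" by blast
  have "v \<in> span B" for v
  proof (rule ccontr)
    assume v: "v \<notin> span B"
    define w where "w = v - (\<Sum>e\<in>B. h v e *\<^sub>R e)"
    define e where "e = (1 / sqrt (h w w)) *\<^sub>R w"
    have "w \<noteq> 0"
    proof
      assume "w = 0"
      then have "v = (\<Sum>e\<in>B. h v e *\<^sub>R e)" by (simp add: w_def)
      also have "\<dots> \<in> span B" by (intro span_sum span_scale span_base)
      finally show False using v by simp
    qed
    then have w: "h w w > 0" by (rule pos)
    have wf: "h w f = 0" if "f \<in> B" for f
      using coeff[OF B that, of "h v"] by (simp add: w_def bilinear_lsub[OF h])
    have ef: "h e f = 0" "h f e = 0" if "f \<in> B" for f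
      using wf[OF that] sym[of f e] by (simp_all add: e_def bilinear_lmul[OF h])
    have ee: "h e e = 1"
      using w by (simp add: e_def bilinear_lmul[OF h] bilinear_rmul[OF h])
    have "e \<notin> B" using ef(1)[of e] ee by auto
    moreover have "on (insert e B)" using B ef ee by (auto simp: on_def)
    ultimately show False using max[of "insert e B"] B by (auto simp: on_def)
  qed
  then have "orthonormal_basis_for h B" using B by (auto simp: orthonormal_basis_for_def on_def)
  then show ?thesis ..
qed

end

theory Submission
  imports Defs
begin

text \<open>
  Everything happens in one tangent space.  Put \<open>\<alpha> = \<nabla>\<omega>\<^sub>I\<close>, \<open>\<beta> = \<nabla>\<omega>\<^sub>J\<close>, \<open>\<gamma> = \<nabla>\<omega>\<^sub>K\<close>; the two
  expressions of \<open>\<nabla>K\<close> obtained from \<open>K = IJ = -JI\<close> give \<open>\<gamma> = J\<^sub>3\<alpha> - I\<^sub>2\<beta> = J\<^sub>2\<alpha> - I\<^sub>3\<beta>\<close>, where \<open>A\<^sub>k\<close> means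
  precomposition of the \<open>k\<close>-th argument with \<open>A\<close>.  Equivalently \<open>\<alpha> = (I\<^sub>2 + I\<^sub>3)\<xi>\<close> and cyclically, for a
  single tensor \<open>\<xi>\<close>.  Twice the \<open>W1 + W2\<close> part of \<open>\<alpha>\<close> is
  \<open>N\<^sub>I = (1 - I\<^sub>1I\<^sub>2)\<alpha> = (I\<^sub>1 + I\<^sub>2 + I\<^sub>3 - I\<^sub>1I\<^sub>2I\<^sub>3)\<xi>\<close>, and with
  \<open>R\<^sub>A = A\<^sub>1 + A\<^sub>2 + A\<^sub>3 + A\<^sub>1A\<^sub>2A\<^sub>3\<close> one has the identity \<open>2N\<^sub>K = R\<^sub>JN\<^sub>I - R\<^sub>IN\<^sub>J\<close>.  As \<open>R\<^sub>A\<close> commutes with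
  permutations of the arguments, this gives (ii).  If \<open>N\<^sub>I = 0\<close>, then \<open>\<gamma> = -R\<^sub>I\<beta>/2\<close>, and \<open>R\<^sub>I\<close> maps each
  Gray-Hervella space of \<open>J\<close> to that of \<open>K\<close>; this gives (i).  Replacing \<open>I\<^sub>1, J\<^sub>1\<close> by \<open>-I\<^sub>1, -J\<^sub>1\<close> turns
  \<open>N\<^sub>I, N\<^sub>J\<close> into the \<open>W3 + W4\<close> parts and leaves \<open>N\<^sub>K\<close> alone, so the same identity expresses \<open>N\<^sub>K\<close> by
  these parts.  This gives (iii), and for (iv) it shows that \<open>N\<^sub>K\<close> is built from a single covector, which
  vanishes as soon as \<open>N\<^sub>K\<close> is totally skew or, in dimension above four, has zero cyclic sum.  In (v),
  \<open>N\<^sub>K\<close> is totally skew and the vanishing traces of \<open>\<alpha>\<close> and \<open>\<beta>\<close> kill its contraction with \<open>\<omega>\<^sub>I\<close>,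
  which in dimension eight determines it.
\<close>

section \<open>Inner products and orthogonal complex structures\<close>

locale inner_prod =
  fixes h :: "'v::euclidean_space \<Rightarrow> 'v \<Rightarrow> real"
  assumes bilinear: "bilinear h"
    and sym: "h x y = h y x"
    and pos: "x \<noteq> 0 \<Longrightarrow> h x x > 0"
begin

lemma lin_left: "linear (\<lambda>x. h x y)" and lin_right: "linear (h x)"
  using bilinear by (auto simp: bilinear_def)

lemmas h_simps [simp] =
  bilinear_ladd[OF bilinear] bilinear_radd[OF bilinear] bilinear_lmul[OF bilinear]
  bilinear_rmul[OF bilinear] bilinear_lneg[OF bilinear] bilinear_rneg[OF bilinear]
  bilinear_lsub[OF bilinear] bilinear_rsub[OF bilinear] bilinear_lzero[OF bilinear]
  bilinear_rzero[OF bilinear]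

lemma eq_0_iff: "h x x = 0 \<longleftrightarrow> x = 0"
  using pos[of x] by (cases "x = 0") auto

text \<open>Trace conditions hold for every orthonormal basis, so they may be applied to the image
  of \<open>B\<close> under \<open>A\<close>, or later under a rotation mixing 1 and
  \<open>I\<close>.\<close>

lemma isometry_basis:
  assumes B: "orthonormal_basis_for h B" and R: "linear R" "\<And>x y. h (R x) (R y) = h x y"
  shows "orthonormal_basis_for h (R ` B)" "inj R"
proof -
  show inj: "inj R"
  proof (subst linear_injective_0[OF R(1)], intro allI impI)
    fix x assume "R x = 0"
    then show "x = 0" using R(2)[of x x] eq_0_iff[of x] by simp
  qed
  have "span (R ` B) = R ` span B" by (simp add: linear_span_image R(1))
  also have "\<dots> = UNIV"
    using B linear_injective_imp_surjective[OF R(1) inj] by (simp add: orthonormal_basis_for_def)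
  finally show "orthonormal_basis_for h (R ` B)"
    using B inj by (auto simp: orthonormal_basis_for_def R(2) dest: injD)
qed

lemma basis_expansion:
  assumes B: "orthonormal_basis_for h B"
  shows "(\<Sum>e\<in>B. h x e *\<^sub>R e) = x"
proof -
  define d where "d = x - (\<Sum>e\<in>B. h x e *\<^sub>R e)"
  have fin: "finite B" and o: "\<And>e f. e \<in> B \<Longrightarrow> f \<in> B \<Longrightarrow> h e f = (if e = f then 1 else 0)"
    using B by (auto simp: orthonormal_basis_for_def)
  have "h d f = 0" if f: "f \<in> B" for f
  proof -
    have "h (\<Sum>e\<in>B. h x e *\<^sub>R e) f = (\<Sum>e\<in>B. h x e * h e f)"
      by (simp add: linear_sum[OF lin_left])
    also have "\<dots> = (\<Sum>e\<in>B. if e = f then h x e else 0)"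
      by (rule sum.cong) (use o f in auto)
    finally show ?thesis using fin f by (simp add: d_def)
  qed
  moreover have "d \<in> span B" using B by (simp add: orthonormal_basis_for_def)
  \<comment> \<open>The functional \<open>h d\<close> vanishes on \<open>B\<close>, hence on the
    span of \<open>B\<close>, which contains \<open>d\<close> itself.\<close>
  ultimately have "h d d = 0"
    using linear_eq_on_span[OF lin_right module_hom_zero, of B d d] by simp
  then have "d = 0" by (simp only: eq_0_iff)
  then show ?thesis by (simp add: d_def)
qed

lemma independent_orthonormal:
  assumes "finite B" and o: "\<And>e f. e \<in> B \<Longrightarrow> f \<in> B \<Longrightarrow> h e f = (if e = f then 1 else 0)"
  shows "independent B"
proof (rule independent_if_scalars_zero)
  fix a f assume 0: "(\<Sum>e\<in>B. a e *\<^sub>R e) = 0" and f: "f \<in> B"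
  have "0 = (\<Sum>e\<in>B. a e * h e f)"
    using arg_cong[OF 0, of "\<lambda>x. h x f"] by (simp add: linear_sum[OF lin_left])
  also have "\<dots> = (\<Sum>e\<in>B. if e = f then a e else 0)"
    by (rule sum.cong) (use o f in auto)
  finally show "a f = 0" using assms(1) f by simp
qed (fact assms(1))

lemma orthonormal_basis_card:
  assumes "orthonormal_basis_for h B"
  shows "card B = DIM('v)"
proof -
  have "independent B"
    using assms by (intro independent_orthonormal) (auto simp: orthonormal_basis_for_def)
  then show ?thesis
    using assms by (metis dim_UNIV dim_eq_card_independent dim_span orthonormal_basis_for_def)
qed

lemma orthonormal_basis_if_card:
  assumes "finite B" and o: "\<And>e f. e \<in> B \<Longrightarrow> f \<in> B \<Longrightarrow> h e f = (if e = f then 1 else 0)"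
    and "card B = DIM('v)"
  shows "orthonormal_basis_for h B"
  using assms card_ge_dim_independent[of B UNIV] independent_orthonormal[OF assms(1) o]
  by (auto simp: orthonormal_basis_for_def)

text \<open>Expand the first argument in \<open>C\<close>, exchange the sums, and recombine the
  second argument in \<open>B\<close>.\<close>

lemma trace_independent:
  assumes t: "\<And>y. linear (\<lambda>x. t x y)" "\<And>x. linear (\<lambda>y. t x y :: real)"
    and B: "orthonormal_basis_for h B" and C: "orthonormal_basis_for h C"
  shows "(\<Sum>e\<in>B. t e e) = (\<Sum>e\<in>C. t e e)"
proof -
  have o: "finite C" "\<And>e f. e \<in> C \<Longrightarrow> f \<in> C \<Longrightarrow> h e f = (if e = f then 1 else 0)"
    using C by (auto simp: orthonormal_basis_for_def)
  have exp: "t x y = (\<Sum>e\<in>C. h x e * t e y)" for x y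
  proof -
    have "t x y = t (\<Sum>e\<in>C. h x e *\<^sub>R e) y" by (simp add: basis_expansion[OF C])
    then show ?thesis by (simp add: linear_sum[OF t(1)] linear_cmul[OF t(1)])
  qed
  have exp': "t x y = (\<Sum>e\<in>B. h y e * t x e)" for x y
  proof -
    have "t x y = t x (\<Sum>e\<in>B. h y e *\<^sub>R e)" by (simp add: basis_expansion[OF B])
    then show ?thesis by (simp add: linear_sum[OF t(2)] linear_cmul[OF t(2)])
  qed
  have "(\<Sum>e\<in>B. t e e) = (\<Sum>e\<in>B. \<Sum>f\<in>C. h e f * t f e)"
    by (rule sum.cong[OF refl exp])
  also have "\<dots> = (\<Sum>f\<in>C. \<Sum>e\<in>B. h f e * t f e)"
    by (subst sum.swap) (simp add: sym)
  also have "\<dots> = (\<Sum>f\<in>C. t f f)"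
    by (rule sum.cong[OF refl exp'[symmetric]])
  finally show ?thesis .
qed

text \<open>Representing each functional \<open>h y x\<close> of \<open>y\<close> by the Euclidean
  inner product with a vector \<open>a x\<close> reduces this to the Euclidean dimension
  count.\<close>

lemma orthogonal_vector_exists:
  assumes "finite S" "card S < DIM('v)"
  shows "\<exists>y. y \<noteq> 0 \<and> (\<forall>x\<in>S. h y x = 0)"
proof -
  have "\<exists>a. \<forall>y. a \<bullet> y = h y x" for x
    using inner_product_representation[of "(\<bullet>)" "\<lambda>y. h y x"] lin_left
    by (metis bilinear_conv_bounded_bilinear bounded_bilinear_inner inner_gt_zero_iff)
  then obtain a where a: "\<And>x y. a x \<bullet> y = h y x" by metis
  have "dim (a ` S) < DIM('v)"
    using dim_le_card'[of "a ` S"] card_image_le[of S a] assms by simp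
  then obtain y where "y \<noteq> 0" "\<And>z. z \<in> span (a ` S) \<Longrightarrow> orthogonal y z"
    using orthogonal_to_subspace_exists[of "a ` S"] by metis
  then show ?thesis
    using a by (metis imageI inner_commute orthogonal_def span_base)
qed

end

locale hermitian = inner_prod h for h :: "'v::euclidean_space \<Rightarrow> 'v \<Rightarrow> real" +
  fixes A :: "'v \<Rightarrow> 'v"
  assumes linear_A: "linear A" and square: "A (A x) = - x" and orth: "h (A x) (A y) = h x y"
begin

lemma skew: "h (A x) y = - h x (A y)"
  using orth[of x "A y"] by (simp add: square)

lemma h_A_self [simp]: "h x (A x) = 0"
  using skew[of x x] sym[of "A x" x] by simp

lemmas A_simps = linear_add[OF linear_A] linear_diff[OF linear_A] linear_neg[OF linear_A]
  linear_cmul[OF linear_A] linear_0[OF linear_A] square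

end

section \<open>Gray-Hervella classes\<close>

lemma GH_spaceD:
  assumes "b \<in> GH_space A"
  shows "linear (\<lambda>x. b x y z)" "linear (\<lambda>y. b x y z)" "linear (\<lambda>z. b x y z)"
    "b x y z = - b x z y" "b x (A y) (A z) = - b x y z"
  using assms unfolding GH_space_def by blast+

lemma GH_space_minus:
  assumes "b \<in> GH_space A"
  shows "b (- x) y z = - b x y z" "b x (- y) z = - b x y z" "b x y (- z) = - b x y z"
  using linear_neg[OF GH_spaceD(1)[OF assms]] linear_neg[OF GH_spaceD(2)[OF assms]]
    linear_neg[OF GH_spaceD(3)[OF assms]] by blast+

lemma GH_summand_subset: "GH_summand h A i \<subseteq> GH_space A"
  by (cases i) auto

lemma GH_space_sum:
  assumes "\<And>i. i \<in> S \<Longrightarrow> w i \<in> GH_space A"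
  shows "(\<lambda>x y z. \<Sum>i\<in>S. w i x y z) \<in> GH_space A"
proof -
  note w = GH_spaceD[OF assms]
  show ?thesis
    unfolding GH_space_def mem_Collect_eq
  proof (intro conjI allI)
    fix x y z
    show "linear (\<lambda>x. \<Sum>i\<in>S. w i x y z)" "linear (\<lambda>y. \<Sum>i\<in>S. w i x y z)"
      "linear (\<lambda>z. \<Sum>i\<in>S. w i x y z)"
      using w(1-3) by (auto intro!: linear_compose_sum)
    show "(\<Sum>i\<in>S. w i x y z) = - (\<Sum>i\<in>S. w i x z y)"
      "(\<Sum>i\<in>S. w i x (A y) (A z)) = - (\<Sum>i\<in>S. w i x y z)"
      unfolding sum_negf[symmetric] by (rule sum.cong[OF refl], erule w)+
  qed
qed

lemma GH_class_subset: "GH_class h A S \<subseteq> GH_space A"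
proof
  fix b assume "b \<in> GH_class h A S"
  then obtain w where w: "\<And>i. i \<in> S \<Longrightarrow> w i \<in> GH_summand h A i"
    and b: "b = (\<lambda>x y z. \<Sum>i\<in>S. w i x y z)"
    unfolding GH_class_def by auto
  show "b \<in> GH_space A"
    unfolding b by (rule GH_space_sum) (use w GH_summand_subset in blast)
qed

context hermitian
begin

text \<open>Polarisation gives total skewness, so a pair of \<open>A\<close>'s on the first two
  arguments can be moved to the last two, where it costs a sign.\<close>

lemma GH_W1: "b (A x) (A y) z = - b x y z" "b y x z = - b x y z" if "b \<in> GH_summand h A W1"
proof -
  have b: "b \<in> GH_space A" and alt: "\<And>x z. b x x z = 0" using that by auto
  have swap: "b y x z = - b x y z" for x y z
    using alt[of "x + y" z, unfolded linear_add[OF GH_spaceD(1)[OF b]]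
      linear_add[OF GH_spaceD(2)[OF b]]] alt[of x z] alt[of y z] by simp
  show "b y x z = - b x y z" by fact
  have "b (A x) (A y) z = b z (A x) (A y)"
    using swap[of "A x" z "A y"] GH_spaceD(4)[OF b, of "A x" "A y" z] by simp
  also have "\<dots> = - b z x y" using GH_spaceD(5)[OF b] by simp
  also have "b z x y = b x y z"
    using swap[of x z y] GH_spaceD(4)[OF b, of x y z] by simp
  finally show "b (A x) (A y) z = - b x y z" .
qed

text \<open>Write P(x,y,z) for \<open>b (A x) (A y) z\<close>. The cyclic identity at
  \<open>A x, A y, z\<close> becomes P(x,y,z) + P(y,z,x) = \<open>b z x y\<close>; its three cyclic
  rotations determine P.\<close>

lemma GH_W2: "b (A x) (A y) z = - b x y z" if "b \<in> GH_summand h A W2"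
proof -
  have b: "b \<in> GH_space A" and cyc: "\<And>x y z. b x y z + b y z x + b z x y = 0" using that by auto
  have move: "b u (A v) w = b u v (A w)" for u v w
    using GH_spaceD(5)[OF b, of u v "A w"] GH_space_minus(3)[OF b] by (simp add: square)
  have "b (A x) (A y) z + b (A y) (A z) x = b z x y" for x y z
    using cyc[of "A x" "A y" z] GH_spaceD(5)[OF b, of z x y] move[of "A y" z x] by simp
  from this[of x y z] this[of y z x] this[of z x y] cyc[of x y z] show ?thesis by simp
qed

lemma GH_W4:
  assumes "linear \<beta>" and b: "\<And>x y z. b x y z = h x y * \<beta> z - h x z * \<beta> y
    - h x (A y) * \<beta> (A z) + h x (A z) * \<beta> (A y)"
  shows "b \<in> GH_summand h A W4" "b (A x) (A y) z = b x y z"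
proof -
  note lin = A_simps linear_add[OF assms(1)] linear_neg[OF assms(1)] linear_cmul[OF assms(1)]
  have "b \<in> GH_space A"
    unfolding GH_space_def mem_Collect_eq
    by (intro conjI allI linearI) (simp_all add: b lin algebra_simps)
  then show "b \<in> GH_summand h A W4" using assms by auto
  show "b (A x) (A y) z = b x y z" by (simp add: b lin skew)
qed

end

declare GH_summand.simps [simp del]

lemma GH_class_empty: "GH_class h A {} = {\<lambda>x y z. 0}"
  by (auto simp: GH_class_def)

lemma GH_class_insertE:
  assumes "b \<in> GH_class h A (insert i S)" and "i \<notin> S"
  obtains w b' where "w \<in> GH_summand h A i" and "b' \<in> GH_class h A S"
    and "b = (\<lambda>x y z. w x y z + b' x y z)"
proof -
  from assms(1) obtain w where "\<And>j. j \<in> insert i S \<Longrightarrow> w j \<in> GH_summand h A j"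
    and "b = (\<lambda>x y z. \<Sum>j\<in>insert i S. w j x y z)"
    unfolding GH_class_def by auto
  then show ?thesis
    using assms(2) that[of "w i" "\<lambda>x y z. \<Sum>j\<in>S. w j x y z"]
    by (auto simp: GH_class_def finite_GH_index)
qed

lemma GH_class_insertI:
  assumes "w \<in> GH_summand h A i" and "b' \<in> GH_class h A S" and "i \<notin> S"
    and b: "\<And>x y z. b x y z = w x y z + b' x y z"
  shows "b \<in> GH_class h A (insert i S)"
proof -
  from assms(2) obtain v where v: "\<And>j. j \<in> S \<Longrightarrow> v j \<in> GH_summand h A j"
    and b': "b' = (\<lambda>x y z. \<Sum>j\<in>S. v j x y z)"
    unfolding GH_class_def by auto
  have "(\<Sum>j\<in>S. (v(i := w)) j x y z) = (\<Sum>j\<in>S. v j x y z)" for x y z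
    by (rule sum.cong) (use assms(3) in auto)
  then have "b = (\<lambda>x y z. \<Sum>j\<in>insert i S. (v(i := w)) j x y z)"
    using assms(3) by (simp add: b b' finite_GH_index fun_eq_iff)
  moreover have "\<forall>j\<in>insert i S. (v(i := w)) j \<in> GH_summand h A j"
    using v assms(1) by simp
  ultimately show ?thesis
    unfolding GH_class_def by blast
qed

lemma GH_spaceI:
  assumes "\<And>y z. linear (\<lambda>x. b x y z)" "\<And>x z. linear (\<lambda>y. b x y z)" "\<And>x y. linear (\<lambda>z. b x y z)"
    and "\<And>x y z. b x y z = - b x z y" and "\<And>x y z. b x (A y) (A z) = - b x y z"
  shows "b \<in> GH_space A"
  unfolding GH_space_def mem_Collect_eq by (intro conjI allI; fact assms)

lemma GH_space_add:
  assumes "b \<in> GH_space A" "b' \<in> GH_space A"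
  shows "(\<lambda>x y z. b x y z + b' x y z) \<in> GH_space A"
proof (rule GH_spaceI)
  note b = GH_spaceD[OF assms(1)] and b' = GH_spaceD[OF assms(2)]
  fix x y z
  show "linear (\<lambda>x. b x y z + b' x y z)" by (rule linear_compose_add[OF b(1) b'(1)])
  show "linear (\<lambda>y. b x y z + b' x y z)" by (rule linear_compose_add[OF b(2) b'(2)])
  show "linear (\<lambda>z. b x y z + b' x y z)" by (rule linear_compose_add[OF b(3) b'(3)])
  show "b x y z + b' x y z = - (b x z y + b' x z y)" using b(4)[of x y z] b'(4)[of x y z] by simp
  show "b x (A y) (A z) + b' x (A y) (A z) = - (b x y z + b' x y z)" using b(5) b'(5) by simp
qed

lemma GH_space_cmul:
  assumes "b \<in> GH_space A"
  shows "(\<lambda>x y z. c * b x y z) \<in> GH_space A"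
proof (rule GH_spaceI)
  note b = GH_spaceD[OF assms]
  have scale: "linear (\<lambda>x. c * f x)" if "linear f" for f :: "'a \<Rightarrow> real"
    using linear_compose_scale_right[OF that, of c] by simp
  fix x y z
  show "linear (\<lambda>x. c * b x y z)" by (rule scale[OF b(1)])
  show "linear (\<lambda>y. c * b x y z)" by (rule scale[OF b(2)])
  show "linear (\<lambda>z. c * b x y z)" by (rule scale[OF b(3)])
  show "c * b x y z = - (c * b x z y)" using b(4)[of x y z] by simp
  show "c * b x (A y) (A z) = - (c * b x y z)" using b(5) by simp
qed

lemma GH_space_diff:
  assumes "b \<in> GH_space A" "b' \<in> GH_space A"
  shows "(\<lambda>x y z. b x y z - b' x y z) \<in> GH_space A"
  using GH_space_add[OF assms(1) GH_space_cmul[OF assms(2), of "- 1"]] by simp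

text \<open>Twice the \<open>W1 + W2\<close> component; for \<open>\<nabla>\<omega>\<^sub>A\<close> it is equivalent to the Nijenhuis tensor of \<open>A\<close>.\<close>

definition nij :: "('v \<Rightarrow> 'v) \<Rightarrow> ('v \<Rightarrow> 'v \<Rightarrow> 'v \<Rightarrow> real) \<Rightarrow> 'v \<Rightarrow> 'v \<Rightarrow> 'v \<Rightarrow> real" where
  "nij A b x y z = b x y z - b (A x) (A y) z"

section \<open>Detecting the classes by the action of \<open>A\<close> on the first two
  arguments\<close>

context hermitian
begin

lemma GH_space_rotate:
  assumes b: "b \<in> GH_space A"
  shows "(\<lambda>x y z. b (A x) (A y) z) \<in> GH_space A"
proof -
  note l = GH_spaceD[OF b]
  show ?thesis
  proof (rule GH_spaceI)
    fix x y z
    show "linear (\<lambda>x. b (A x) (A y) z)" "linear (\<lambda>y. b (A x) (A y) z)" "linear (b (A x) (A y))"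
      using linear_compose[OF linear_A l(1)] linear_compose[OF linear_A l(2)] l(3)
      by (simp_all only: o_def)
    show "b (A x) (A y) z = - b (A x) (A z) y"
      using l(4)[of "A x" "A y" z] l(5)[of "A x" z "A y"] GH_space_minus(3)[OF b] by (simp add: square)
    show "b (A x) (A (A y)) (A z) = - b (A x) (A y) z" by (rule l(5))
  qed
qed

lemma nij_in_GH_space:
  assumes "b \<in> GH_space A"
  shows "nij A b \<in> GH_space A"
  using GH_space_diff[OF assms GH_space_rotate[OF assms]] unfolding nij_def .

lemma GH_W3: "b (A x) (A y) z = b x y z" if "b \<in> GH_summand h A W3"
  using that by (simp add: GH_summand.simps)

lemma GH_W4D:
  assumes "b \<in> GH_summand h A W4"
  obtains \<beta> where "linear \<beta>" and "\<And>x y z. b x y z = h x y * \<beta> z - h x z * \<beta> y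
    - h x (A y) * \<beta> (A z) + h x (A z) * \<beta> (A y)"
  using assms by (auto simp: GH_summand.simps)

lemma GH_W4_rotate: "b (A x) (A y) z = b x y z" if "b \<in> GH_summand h A W4"
  using GH_W4D[OF that] GH_W4(2) by metis

lemma class_34D:
  assumes "b \<in> GH_class h A {W3, W4}"
  shows "b (A x) (A y) z = b x y z"
  using assms
  by (auto elim!: GH_class_insertE simp: GH_class_empty GH_W3 GH_W4_rotate)

lemma class_12D:
  assumes "b \<in> GH_class h A {W1, W2}"
  shows "b (A x) (A y) z = - b x y z"
  using assms
  by (auto elim!: GH_class_insertE simp: GH_class_empty GH_W1(1) GH_W2)

lemma class_124D:
  assumes "b \<in> GH_class h A {W1, W2, W4}"
  obtains \<beta> where "linear \<beta>" and "\<And>x y z. b x y z + b (A x) (A y) z = 2 *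
    (h x y * \<beta> z - h x z * \<beta> y - h x (A y) * \<beta> (A z) + h x (A z) * \<beta> (A y))"
proof -
  obtain b1 b2 b4 where b: "\<And>x y z. b x y z = b1 x y z + (b2 x y z + b4 x y z)"
    and 1: "b1 \<in> GH_summand h A W1" and 2: "b2 \<in> GH_summand h A W2" and 4: "b4 \<in> GH_summand h A W4"
    using assms by (auto elim!: GH_class_insertE simp: GH_class_empty)
  obtain \<beta> where \<beta>: "linear \<beta>" "\<And>x y z. b4 x y z = h x y * \<beta> z - h x z * \<beta> y
    - h x (A y) * \<beta> (A z) + h x (A z) * \<beta> (A y)" using GH_W4D[OF 4] by blast
  have "b x y z + b (A x) (A y) z = 2 * b4 x y z" for x y z
    by (simp add: b GH_W1(1)[OF 1] GH_W2[OF 2] GH_W4_rotate[OF 4])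
  then show ?thesis using that \<beta> by simp
qed

text \<open>Rotating the first two arguments by \<open>A\<close> acts as -1 on W1 and W2 and as 1 on
  W3 and W4, so \<open>nij\<close> doubles the former and kills the latter.\<close>

lemma class_C34D:
  assumes "b \<in> GH_class h A {C, W3, W4}" and C: "C \<in> {W1, W2}"
  obtains w where "w \<in> GH_summand h A C" "\<And>x y z. nij A b x y z = 2 * w x y z"
proof -
  have "C \<notin> {W3, W4}" using C by auto
  with assms(1) obtain w b' where w: "w \<in> GH_summand h A C" and b': "b' \<in> GH_class h A {W3, W4}"
    and b: "b = (\<lambda>x y z. w x y z + b' x y z)"
    by (rule GH_class_insertE)
  have "w (A x) (A y) z = - w x y z" for x y z
    using C w GH_W1(1)[of w] GH_W2[of w] by blast
  then have "nij A b x y z = 2 * w x y z" for x y z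
    using class_34D[OF b'] by (simp add: nij_def b)
  then show ?thesis using that w by blast
qed

lemma class_134D:
  assumes "b \<in> GH_class h A {W1, W3, W4}"
  shows "nij A b y x z = - nij A b x y z"
proof (rule class_C34D[OF assms])
  fix w assume "w \<in> GH_summand h A W1" and w: "\<And>x y z. nij A b x y z = 2 * w x y z"
  then show ?thesis using GH_W1(2)[of w x y z] unfolding w by simp
qed simp

lemma class_234D:
  assumes "b \<in> GH_class h A {W2, W3, W4}"
  shows "nij A b x y z + nij A b y z x + nij A b z x y = 0"
proof (rule class_C34D[OF assms])
  fix w assume "w \<in> GH_summand h A W2" and w: "\<And>x y z. nij A b x y z = 2 * w x y z"
  then have "w x y z + w y z x + w z x y = 0" by (simp add: GH_summand.simps)
  then show ?thesis unfolding w by simp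
qed simp

text \<open>A W4 tensor with one-form \<theta> has trace (dim - 2) \<theta> over its first two
  arguments. Dividing the trace of \<open>b\<close> by dim - 2 therefore gives the one-form of the
  W4 part, and the trace-free remainder lies in W3.\<close>

lemma class_34I:
  assumes b: "b \<in> GH_space A" and rot: "\<And>x y z. b (A x) (A y) z = b x y z" and dim: "DIM('v) > 2"
  shows "b \<in> GH_class h A {W3, W4}"
proof -
  obtain B0 where B0: "orthonormal_basis_for h B0"
    using orthonormal_basis_for_exists[OF bilinear sym pos] by blast
  define \<theta> where "\<theta> z = (\<Sum>e\<in>B0. b e e z) / (real DIM('v) - 2)" for z
  define w where "w x y z = h x y * \<theta> z - h x z * \<theta> y - h x (A y) * \<theta> (A z) + h x (A z) * \<theta> (A y)" for x y z
  note l = GH_spaceD[OF b]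
  have lin: "linear \<theta>"
    by (rule linearI)
      (simp_all add: \<theta>_def linear_add[OF l(3)] linear_cmul[OF l(3)] sum.distrib add_divide_distrib
        sum_distrib_left)
  have w: "w \<in> GH_summand h A W4" "\<And>x y z. w (A x) (A y) z = w x y z"
    using GH_W4[OF lin w_def] by auto
  then have wG: "w \<in> GH_space A" using GH_summand_subset by blast
  have "(\<Sum>e\<in>B. b e e z - w e e z) = 0" if B: "orthonormal_basis_for h B" for B z
  proof -
    have exp: "(\<Sum>e\<in>B. h e x * \<theta> (f e)) = \<theta> (f x)" if "linear f" for x f
    proof -
      have "linear (\<lambda>x. \<theta> (f x))" using linear_compose[OF that lin] by (simp add: o_def)
      from linear_sum[OF this, of "\<lambda>e. h x e *\<^sub>R e" B] linear_cmul[OF this]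
      show ?thesis using basis_expansion[OF B, of x] by (simp add: sym[of x])
    qed
    have "(\<Sum>e\<in>B. w e e z) = (\<Sum>e\<in>B. h e e * \<theta> z) - \<theta> z + \<theta> (A (A z))"
      using exp[OF linear_ident, of z] exp[OF linear_A, of "A z"]
      by (simp add: w_def sum.distrib sum_subtractf)
    also have "(\<Sum>e\<in>B. h e e * \<theta> z) = (\<Sum>e\<in>B. \<theta> z)"
      by (rule sum.cong) (use B in \<open>auto simp: orthonormal_basis_for_def\<close>)
    also have "(\<Sum>e\<in>B. \<theta> z) - \<theta> z + \<theta> (A (A z)) = (real DIM('v) - 2) * \<theta> z"
      by (simp add: square linear_neg[OF lin] orthonormal_basis_card[OF B] algebra_simps)
    also have "\<dots> = (\<Sum>e\<in>B0. b e e z)" using dim by (simp add: \<theta>_def)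
    also have "\<dots> = (\<Sum>e\<in>B. b e e z)"
      using trace_independent[OF l(1,2) B0 B] by blast
    finally show ?thesis by (simp add: sum_subtractf)
  qed
  then have "(\<lambda>x y z. b x y z - w x y z) \<in> GH_summand h A W3"
    using GH_space_diff[OF b wG] rot w(2) by (simp add: GH_summand.simps)
  moreover have "w \<in> GH_class h A {W4}"
    by (rule GH_class_insertI[OF w(1), of "\<lambda>x y z. 0"]) (simp_all add: GH_class_empty)
  ultimately show ?thesis by (rule GH_class_insertI) simp_all
qed

text \<open>Removing half of \<open>nij A b\<close> leaves the average of \<open>b\<close> and its
  rotation by \<open>A\<close>. The rotation is an involution, so this average is invariant and
  \<open>class_34I\<close> applies.\<close>

lemma class_C34I:
  assumes b: "b \<in> GH_space A" and dim: "DIM('v) > 2" and C: "C \<in> {W1, W2}"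
    and w: "(\<lambda>x y z. nij A b x y z / 2) \<in> GH_summand h A C"
  shows "b \<in> GH_class h A {C, W3, W4}"
proof -
  let ?w = "\<lambda>x y z. nij A b x y z / 2"
  have sym_rot: "b (A (A x)) (A (A y)) z = b x y z" for x y z
    by (simp add: square GH_space_minus[OF b])
  have "(\<lambda>x y z. b x y z - ?w x y z) \<in> GH_class h A {W3, W4}"
    using w GH_summand_subset
    by (intro class_34I GH_space_diff[OF b] dim) (auto simp: nij_def sym_rot field_simps)
  with w show ?thesis by (rule GH_class_insertI) (use C in auto)
qed

lemma class_134I:
  assumes b: "b \<in> GH_space A" and dim: "DIM('v) > 2"
    and alt: "\<And>x y z. nij A b y x z = - nij A b x y z"
  shows "b \<in> GH_class h A {W1, W3, W4}"
proof (rule class_C34I[OF b dim])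
  show "(\<lambda>x y z. nij A b x y z / 2) \<in> GH_summand h A W1"
    using GH_space_cmul[OF nij_in_GH_space[OF b], of "1/2"] alt[of x x for x]
    by (auto simp: GH_summand.simps)
qed simp

lemma class_234I:
  assumes b: "b \<in> GH_space A" and dim: "DIM('v) > 2"
    and cyc: "\<And>x y z. nij A b x y z + nij A b y z x + nij A b z x y = 0"
  shows "b \<in> GH_class h A {W2, W3, W4}"
proof (rule class_C34I[OF b dim])
  show "(\<lambda>x y z. nij A b x y z / 2) \<in> GH_summand h A W2"
    using GH_space_cmul[OF nij_in_GH_space[OF b], of "1/2"] cyc
    by (auto simp: GH_summand.simps add_divide_distrib[symmetric])
qed simp

text \<open>For the W2 part, replacing \<open>B\<close> by its image under \<open>A\<close>
  preserves the trace, whereas \<open>GH_W2\<close> says that it changes sign.\<close>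

lemma class_123_trace:
  assumes "b \<in> GH_class h A {W1, W2, W3}" and B: "orthonormal_basis_for h B"
  shows "(\<Sum>e\<in>B. b e e z) = 0"
proof -
  obtain b1 b2 b3 where b: "\<And>x y z. b x y z = b1 x y z + (b2 x y z + b3 x y z)"
    and 1: "b1 \<in> GH_summand h A W1" and 2: "b2 \<in> GH_summand h A W2" and 3: "b3 \<in> GH_summand h A W3"
    using assms by (auto elim!: GH_class_insertE simp: GH_class_empty)
  have "b2 \<in> GH_space A" using 2 GH_summand_subset by blast
  note l = GH_spaceD[OF this]
  have "(\<Sum>e\<in>B. b2 e e z) = (\<Sum>e\<in>A ` B. b2 e e z)"
    using trace_independent[OF l(1,2) B isometry_basis(1)[OF B linear_A orth]] .
  also have "\<dots> = (\<Sum>e\<in>B. b2 (A e) (A e) z)"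
    using isometry_basis(2)[OF B linear_A orth] by (subst sum.reindex) (auto simp: inj_on_def)
  also have "\<dots> = - (\<Sum>e\<in>B. b2 e e z)" by (simp add: GH_W2[OF 2] sum_negf)
  finally have "(\<Sum>e\<in>B. b2 e e z) = 0" by simp
  moreover have "b1 e e z = 0" for e using 1 by (simp add: GH_summand.simps)
  moreover have "(\<Sum>e\<in>B. b3 e e z) = 0" using 3 B by (simp add: GH_summand.simps)
  ultimately show ?thesis by (simp add: b sum.distrib)
qed

end

section \<open>Quaternionic linear algebra\<close>

definition rot :: "('v \<Rightarrow> 'v) \<Rightarrow> ('v \<Rightarrow> 'v \<Rightarrow> 'v \<Rightarrow> real) \<Rightarrow> 'v \<Rightarrow> 'v \<Rightarrow> 'v \<Rightarrow> real" where
  "rot A b x y z = b (A x) y z + b x (A y) z + b x y (A z) + b (A x) (A y) (A z)"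

lemma rot_alternating:
  assumes "\<And>x y z. b y x z = - b x y z"
  shows "rot A b y x z = - rot A b x y z"
  using assms[of y "A x" z] assms[of "A y" x z] assms[of y x "A z"] assms[of "A y" "A x" "A z"]
  by (simp add: rot_def)

lemma rot_cyclic:
  assumes "\<And>x y z. b x y z + b y z x + b z x y = 0"
  shows "rot A b x y z + rot A b y z x + rot A b z x y = 0"
  using assms[of "A x" y z] assms[of x "A y" z] assms[of x y "A z"] assms[of "A x" "A y" "A z"]
  by (simp add: rot_def)

locale hyperhermitian = I: hermitian h I + J: hermitian h J + K: hermitian h K
  for h :: "'v::euclidean_space \<Rightarrow> 'v \<Rightarrow> real" and I J K :: "'v \<Rightarrow> 'v" +
  assumes K_IJ: "K x = I (J x)" and K_JI: "K x = - J (I x)"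
begin

lemma products:
  "I (J x) = K x" "J (I x) = - K x" "J (K x) = I x" "K (J x) = - I x" "K (I x) = J x" "I (K x) = - J x"
proof -
  show "I (J x) = K x" "J (I x) = - K x" by (simp_all only: K_IJ[symmetric] K_JI) simp
  show "J (K x) = I x" unfolding K_JI by (simp add: J.A_simps)
  show "K (J x) = - I x" unfolding K_IJ by (simp add: I.A_simps J.square)
  show "K (I x) = J x" unfolding K_JI by (simp add: J.A_simps I.square)
  show "I (K x) = - J x" unfolding K_IJ by (simp add: I.square)
qed

lemmas q_simps = products I.A_simps J.A_simps K.A_simps I.skew J.skew K.skew

lemma orthogonal_vector_exists_quaternion:
  assumes "DIM('v) > 4"
  obtains y where "y \<noteq> 0" "h y x = 0" "h y (I x) = 0" "h y (J x) = 0" "h y (K x) = 0"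
proof -
  have "card {x, I x, J x, K x} < DIM('v)"
    using assms card_length[of "[x, I x, J x, K x]"] by simp
  from I.orthogonal_vector_exists[OF _ this] show ?thesis using that by auto
qed

text \<open>Since K = -JI, rotating the last two arguments by \<open>K\<close> swaps the first and
  fourth terms of \<open>rot I b\<close>, and the second and third, with the sign coming from
  \<open>b \<in> GH_space J\<close>.\<close>

lemma rot_in_GH_space:
  assumes "b \<in> GH_space J"
  shows "rot I b \<in> GH_space K"
proof -
  note l = GH_spaceD[OF assms]
  note lin = linear_add[OF l(1)] linear_add[OF l(2)] linear_add[OF l(3)]
    linear_cmul[OF l(1)] linear_cmul[OF l(2)] linear_cmul[OF l(3)] GH_space_minus[OF assms]
  show ?thesis
  proof (rule GH_spaceI)
    fix x y z
    show "linear (\<lambda>x. rot I b x y z)" "linear (\<lambda>y. rot I b x y z)" "linear (\<lambda>z. rot I b x y z)"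
      by (rule linearI; simp add: rot_def lin I.A_simps algebra_simps)+
    show "rot I b x y z = - rot I b x z y"
      using l(4)[of "I x" y z] l(4)[of x "I y" z] l(4)[of x y "I z"] l(4)[of "I x" "I y" "I z"]
      by (simp add: rot_def)
    show "rot I b x (K y) (K z) = - rot I b x y z"
      using l(5)[of "I x" "I y" "I z"] l(5)[of x y "I z"] l(5)[of x "I y" z] l(5)[of "I x" y z]
      by (simp add: rot_def q_simps lin)
  qed
qed

lemma rot_trace:
  assumes b: "b \<in> GH_space J"
    and tr: "\<And>B z. orthonormal_basis_for h B \<Longrightarrow> (\<Sum>e\<in>B. b e e z) = 0"
    and B: "orthonormal_basis_for h B"
  shows "(\<Sum>e\<in>B. rot I b e e z) = 0"
proof -
  note l = GH_spaceD[OF b]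
  note lin = linear_add[OF l(1)] linear_add[OF l(2)] linear_cmul[OF l(1)] linear_cmul[OF l(2)]
  have tr': "(\<Sum>e\<in>B. b (R e) (R e) z) = 0" if "linear R" "\<And>x y. h (R x) (R y) = h x y" for R z
    using tr[OF I.isometry_basis(1)[OF B that]] I.isometry_basis(2)[OF B that]
    by (subst (asm) sum.reindex) (auto simp: inj_on_def)
  have tr_I: "(\<Sum>e\<in>B. b (I e) (I e) z) = 0" for z
    by (rule tr'[OF I.linear_A I.orth])
  \<comment> \<open>The traces over \<open>B\<close> and over the isometric image \<open>R ` B\<close> differ by the mixed terms.\<close>
  define R where "R x = (1 / sqrt 2) *\<^sub>R (x + I x)" for x
  have "linear R" by (rule linearI) (simp_all add: R_def I.A_simps algebra_simps)
  moreover have "h (R x) (R y) = h x y" for x y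
    by (simp add: R_def q_simps field_simps)
  ultimately have "(\<Sum>e\<in>B. b (R e) (R e) z) = 0" by (rule tr')
  moreover have "b (R e) (R e) z = (b e e z + b (I e) (I e) z + (b (I e) e z + b e (I e) z)) / 2" for e
    by (simp add: R_def lin field_simps)
  ultimately have "(\<Sum>e\<in>B. b (I e) e z + b e (I e) z) = 0"
    by (simp add: sum.distrib sum_divide_distrib[symmetric] tr[OF B] tr_I)
  then show ?thesis by (simp add: rot_def sum.distrib tr[OF B] tr_I)
qed

text \<open>For W1 and W2, \<open>rot I\<close> commutes with permutations of the arguments. For W3,
  rotating the first two arguments by \<open>K\<close> merely permutes the four terms of
  \<open>rot I b\<close>.\<close>

lemma rot_summand:
  assumes b: "b \<in> GH_summand h J i"
  shows "(\<lambda>x y z. - rot I b x y z / 2) \<in> GH_summand h K i"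
proof -
  have bG: "b \<in> GH_space J" using b GH_summand_subset by blast
  have rG: "(\<lambda>x y z. - rot I b x y z / 2) \<in> GH_space K"
    using GH_space_cmul[OF rot_in_GH_space[OF bG], of "- 1 / 2"] by simp
  show ?thesis
  proof (cases i)
    case W1
    then have "rot I b x x z = 0" for x z
      using rot_alternating[of b I x x z] J.GH_W1(2) b by simp
    then show ?thesis using rG W1 by (simp add: GH_summand.simps)
  next
    case W2
    then have cyc: "b x y z + b y z x + b z x y = 0" for x y z
      using b by (simp add: GH_summand.simps)
    have "- rot I b x y z / 2 + - rot I b y z x / 2 + - rot I b z x y / 2 = 0" for x y z
      using rot_cyclic[of b, OF cyc, of I x y z] by simp
    then show ?thesis using rG W2 by (simp add: GH_summand.simps)
  next
    case W3
    note r = J.GH_W3[OF b[unfolded W3]] and m = GH_space_minus[OF bG]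
    have "rot I b (K x) (K y) z = rot I b x y z" for x y z
      using r[of x "I y" z] r[of "I x" y z] r[of "I x" "I y" "I z"] r[of x y "I z"]
        r[of "I x" "I y" z]
      by (simp add: rot_def q_simps m)
    moreover have "(\<Sum>e\<in>B. - rot I b e e z / 2) = 0" if "orthonormal_basis_for h B" for B z
      using rot_trace[OF bG _ that] b W3
      by (simp add: GH_summand.simps sum_negf sum_divide_distrib[symmetric])
    ultimately show ?thesis using rG W3 by (simp add: GH_summand.simps)
  next
    case W4
    with b obtain \<beta> where lin: "linear \<beta>" and eq: "\<And>x y z. b x y z = h x y * \<beta> z - h x z * \<beta> y
      - h x (J y) * \<beta> (J z) + h x (J z) * \<beta> (J y)" using J.GH_W4D by blast
    \<comment> \<open>This one-form is read off from traces: the trace of \<open>rot I b\<close> at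
      \<open>z\<close> is twice that of \<open>b\<close> at \<open>I z\<close>.\<close>
    have "linear (\<lambda>x. - \<beta> (I x))"
      using linear_compose[OF I.linear_A lin] by (simp add: o_def linear_compose_neg)
    moreover have "- rot I b x y z / 2 = h x y * - \<beta> (I z) - h x z * - \<beta> (I y)
      - h x (K y) * - \<beta> (I (K z)) + h x (K z) * - \<beta> (I (K y))" for x y z
      by (simp add: rot_def eq q_simps linear_neg[OF lin])
    ultimately have "(\<lambda>x y z. - rot I b x y z / 2) \<in> GH_summand h K W4"
      by (rule K.GH_W4(1))
    then show ?thesis using W4 by simp
  qed
qed

lemma rot_class:
  assumes "b \<in> GH_class h J S"
  shows "(\<lambda>x y z. - rot I b x y z / 2) \<in> GH_class h K S"
proof -
  obtain w where w: "\<And>i. i \<in> S \<Longrightarrow> w i \<in> GH_summand h J i"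
    and b: "b = (\<lambda>x y z. \<Sum>i\<in>S. w i x y z)"
    using assms unfolding GH_class_def by auto
  have "- rot I b x y z / 2 = (\<Sum>i\<in>S. - rot I (w i) x y z / 2)" for x y z
    by (simp add: rot_def b sum.distrib sum_subtractf sum_negf sum_divide_distrib[symmetric])
  then show ?thesis
    unfolding GH_class_def using rot_summand[OF w]
    by (auto intro!: exI[of _ "\<lambda>i x y z. - rot I (w i) x y z / 2"])
qed

end

section \<open>The tensors of the three structures and the implications between their
  classes\<close>

locale hyperhermitian_torsion = hyperhermitian h I J K
  for h :: "'v::euclidean_space \<Rightarrow> 'v \<Rightarrow> real" and I J K :: "'v \<Rightarrow> 'v" +
  fixes \<alpha> \<beta> \<gamma> :: "'v \<Rightarrow> 'v \<Rightarrow> 'v \<Rightarrow> real"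
  assumes \<alpha>: "\<alpha> \<in> GH_space I" and \<beta>: "\<beta> \<in> GH_space J"
    and \<gamma>_IJ: "\<gamma> x y z = \<alpha> x y (J z) - \<beta> x (I y) z"
    and \<gamma>_JI: "\<gamma> x y z = \<alpha> x (J y) z - \<beta> x y (I z)"
begin

lemmas \<alpha>_minus = GH_space_minus[OF \<alpha>] and \<beta>_minus = GH_space_minus[OF \<beta>]

lemma \<gamma>: "\<gamma> \<in> GH_space K"
proof (rule GH_spaceI)
  note a = GH_spaceD[OF \<alpha>] and b = GH_spaceD[OF \<beta>]
  fix x y z
  show "linear (\<lambda>x. \<gamma> x y z)" unfolding \<gamma>_IJ by (rule linear_compose_sub[OF a(1) b(1)])
  show "linear (\<lambda>z. \<gamma> x y z)"
    unfolding \<gamma>_IJ by (rule linear_compose_sub[OF linear_compose[OF J.linear_A a(3), unfolded o_def] b(3)])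
  show "linear (\<lambda>y. \<gamma> x y z)"
    unfolding \<gamma>_IJ by (rule linear_compose_sub[OF a(2) linear_compose[OF I.linear_A b(2), unfolded o_def]])
  show "\<gamma> x y z = - \<gamma> x z y"
    using a(4)[of x y "J z"] b(4)[of x "I y" z] unfolding \<gamma>_IJ[of x y z] \<gamma>_JI[of x z y] by simp
  show "\<gamma> x (K y) (K z) = - \<gamma> x y z"
    using a(5)[of x "J y" z] b(5)[of x y "I z"]
    unfolding \<gamma>_IJ[of x "K y"] \<gamma>_JI[of x y z] by (simp add: q_simps \<alpha>_minus \<beta>_minus)
qed

text \<open>Comparing the two expressions for \<open>\<gamma>\<close> at \<open>I x, I y\<close> and
  using the invariance of \<open>\<alpha>\<close> expresses the sum of the two \<alpha>-terms
  through \<open>\<beta>\<close>. Adding the two expressions at \<open>x, y\<close> then eliminates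
  \<open>\<alpha>\<close>.\<close>

lemma \<gamma>_eq_rot:
  assumes rot: "\<And>x y z. \<alpha> (I x) (I y) z = \<alpha> x y z"
  shows "\<gamma> = (\<lambda>x y z. - rot I \<beta> x y z / 2)"
proof (intro ext)
  fix x y z
  have "\<alpha> x y (J z) + \<beta> (I x) y z = - \<alpha> x (J y) z - \<beta> (I x) (I y) (I z)"
    using \<gamma>_IJ[of "I x" "I y" z] \<gamma>_JI[of "I x" "I y" z] rot[of x y "J z"] rot[of x "J y" z]
    by (simp add: q_simps \<alpha>_minus \<beta>_minus)
  then show "\<gamma> x y z = - rot I \<beta> x y z / 2"
    using \<gamma>_IJ[of x y z] \<gamma>_JI[of x y z] by (simp add: rot_def)
qed

text \<open>
  If \<open>\<Xi>\<close> is the skew endomorphism with \<open>\<xi> x y z = h y (\<Xi>\<^sub>x z)\<close>, then \<open>\<nabla>\<^sub>xA = [\<Xi>\<^sub>x, A]\<close> for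
  \<open>A = I, J, K\<close>; conversely \<open>4\<Xi>\<^sub>x = I\<nabla>\<^sub>xI + J\<nabla>\<^sub>xJ + K\<nabla>\<^sub>xK\<close>.
\<close>

definition \<xi> where
  "\<xi> x y z = - (\<alpha> x (I y) z + \<beta> x (J y) z + \<gamma> x (K y) z) / 4"

lemma \<xi>_minus: "\<xi> (- x) y z = - \<xi> x y z" "\<xi> x (- y) z = - \<xi> x y z" "\<xi> x y (- z) = - \<xi> x y z"
  by (simp_all add: \<xi>_def q_simps \<alpha>_minus \<beta>_minus GH_space_minus[OF \<gamma>] field_simps)

text \<open>By \<open>\<gamma>_JI\<close> at \<open>J y, z\<close> and at \<open>K y, I z\<close>,
  the terms in \<open>\<beta>\<close> and \<open>\<gamma>\<close> on the right combine to a multiple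
  of \<open>\<alpha>\<close>.\<close>

lemma \<alpha>_eq: "\<alpha> x y z = \<xi> x (I y) z + \<xi> x y (I z)"
  using GH_spaceD(5)[OF \<alpha>, of x y z] \<gamma>_JI[of x "J y" z] \<gamma>_JI[of x "K y" "I z"]
  by (simp add: \<xi>_def q_simps \<alpha>_minus \<beta>_minus GH_space_minus[OF \<gamma>] field_simps)

lemma \<beta>_eq: "\<beta> x y z = \<xi> x (J y) z + \<xi> x y (J z)"
  using GH_spaceD(5)[OF \<beta>, of x y z] \<gamma>_IJ[of x "I y" z] \<gamma>_IJ[of x "K y" "J z"]
  by (simp add: \<xi>_def q_simps \<alpha>_minus \<beta>_minus GH_space_minus[OF \<gamma>] field_simps)

lemma \<gamma>_eq: "\<gamma> x y z = \<xi> x (K y) z + \<xi> x y (K z)"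
  by (simp add: \<gamma>_IJ \<alpha>_eq \<beta>_eq q_simps \<xi>_minus)

text \<open>In terms of \<open>\<xi>\<close> both sides are sums of words in the units on three
  independent arguments. On the right the words purely in \<open>K\<close> double because
  \<open>I\<close> and \<open>J\<close> anticommute, and all others cancel.\<close>

lemma nij_\<gamma>: "nij K \<gamma> x y z = (rot J (nij I \<alpha>) x y z - rot I (nij J \<beta>) x y z) / 2"
  by (simp add: nij_def rot_def \<alpha>_eq \<beta>_eq \<gamma>_eq q_simps \<xi>_minus field_simps)

text \<open>
  This is \<open>nij_\<gamma>\<close> for the quaternionic triple \<open>(-I, -J, K)\<close> in the first argument; the corrections
  \<open>- 2 * \<dots>\<close> change the sign of the terms of \<open>rot\<close> involving that argument.
\<close>

lemma nij_\<gamma>_twisted: "nij K \<gamma> x y z =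
    (rot J F x y z - 2 * F (J x) y z - 2 * F (J x) (J y) (J z)
     - (rot I G x y z - 2 * G (I x) y z - 2 * G (I x) (I y) (I z))) / 2"
  if F: "\<And>x y z. F x y z = \<alpha> x y z + \<alpha> (I x) (I y) z"
    and G: "\<And>x y z. G x y z = \<beta> x y z + \<beta> (J x) (J y) z"
  by (simp add: nij_def rot_def F G \<alpha>_eq \<beta>_eq \<gamma>_eq q_simps \<xi>_minus field_simps)

lemma class_34_imp:
  assumes "\<alpha> \<in> GH_class h I {W3, W4}" and "\<beta> \<in> GH_class h J S"
  shows "\<gamma> \<in> GH_class h K S"
  using rot_class[OF assms(2)] \<gamma>_eq_rot[OF I.class_34D[OF assms(1)]] by simp

lemma class_134_imp:
  assumes "\<alpha> \<in> GH_class h I {W1, W3, W4}" and "\<beta> \<in> GH_class h J {W1, W3, W4}" and "DIM('v) > 2"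
  shows "\<gamma> \<in> GH_class h K {W1, W3, W4}"
proof (rule K.class_134I[OF \<gamma> assms(3)])
  fix x y z
  show "nij K \<gamma> y x z = - nij K \<gamma> x y z"
    using rot_alternating[of "nij I \<alpha>", OF I.class_134D[OF assms(1)], of J y x z]
      rot_alternating[of "nij J \<beta>", OF J.class_134D[OF assms(2)], of I y x z]
    by (simp add: nij_\<gamma> field_simps)
qed

lemma class_234_imp:
  assumes "\<alpha> \<in> GH_class h I {W2, W3, W4}" and "\<beta> \<in> GH_class h J {W2, W3, W4}" and "DIM('v) > 2"
  shows "\<gamma> \<in> GH_class h K {W2, W3, W4}"
proof (rule K.class_234I[OF \<gamma> assms(3)])
  fix x y z
  show "nij K \<gamma> x y z + nij K \<gamma> y z x + nij K \<gamma> z x y = 0"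
    using rot_cyclic[of "nij I \<alpha>", OF I.class_234D[OF assms(1)], of J x y z]
      rot_cyclic[of "nij J \<beta>", OF J.class_234D[OF assms(2)], of I x y z]
    by (simp add: nij_\<gamma> field_simps)
qed

lemma class_34I_nij:
  assumes "\<And>x y z. nij K \<gamma> x y z = 0" and "DIM('v) > 2"
  shows "\<gamma> \<in> GH_class h K {W3, W4}"
  using assms(1) by (intro K.class_34I[OF \<gamma> _ assms(2)]) (simp add: nij_def)

lemma class_12_imp:
  assumes "\<alpha> \<in> GH_class h I {W1, W2}" and "\<beta> \<in> GH_class h J {W1, W2}" and "DIM('v) > 2"
  shows "\<gamma> \<in> GH_class h K {W3, W4}"
proof (rule class_34I_nij[OF _ assms(3)])
  show "nij K \<gamma> x y z = 0" for x y z
    using nij_\<gamma>_twisted[of "\<lambda>x y z. 0" "\<lambda>x y z. 0" x y z] I.class_12D[OF assms(1)] J.class_12D[OF assms(2)]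
    by (simp add: rot_def)
qed

text \<open>The right-hand side of \<open>nij_\<gamma>_twisted\<close> sees only the W4 parts, and
  their one-forms \<open>s\<close> and \<open>t\<close> enter only through the combination
  \<open>\<phi>\<close>.\<close>

lemma nij_\<gamma>_124:
  assumes "\<alpha> \<in> GH_class h I {W1, W2, W4}" and "\<beta> \<in> GH_class h J {W1, W2, W4}"
  obtains \<phi> where "\<phi> 0 = 0" and "\<And>x y z. nij K \<gamma> x y z = h x (J y) * \<phi> z - h x (I y) * \<phi> (K z)
    - (h x (J z) * \<phi> y - h x (I z) * \<phi> (K y))"
proof -
  obtain s where s: "linear s" and F: "\<And>x y z. \<alpha> x y z + \<alpha> (I x) (I y) z =
      2 * (h x y * s z - h x z * s y - h x (I y) * s (I z) + h x (I z) * s (I y))"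
    using I.class_124D[OF assms(1)] by blast
  obtain t where t: "linear t" and G: "\<And>x y z. \<beta> x y z + \<beta> (J x) (J y) z =
      2 * (h x y * t z - h x z * t y - h x (J y) * t (J z) + h x (J z) * t (J y))"
    using J.class_124D[OF assms(2)] by blast
  define \<phi> where "\<phi> z = 2 * (s z - t (K z))" for z
  have "nij K \<gamma> x y z = h x (J y) * \<phi> z - h x (I y) * \<phi> (K z)
      - (h x (J z) * \<phi> y - h x (I z) * \<phi> (K y))" for x y z
    unfolding nij_\<gamma>_twisted[OF F[symmetric] G[symmetric]]
    by (simp add: rot_def \<phi>_def q_simps linear_neg[OF s] linear_neg[OF t] field_simps)
  moreover have "\<phi> 0 = 0" by (simp add: \<phi>_def linear_0[OF s] linear_0[OF t] K.A_simps)
  ultimately show ?thesis using that by blast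
qed

text \<open>A totally skew \<open>nij K \<gamma>\<close> vanishes at \<open>x, x, J x\<close>, where
  \<open>nij_\<gamma>_124\<close> gives \<open>h x x * \<phi> x\<close>. The case x = 0 is covered
  by \<open>\<phi> 0 = 0\<close>.\<close>

lemma class_124_imp_W1:
  assumes "\<alpha> \<in> GH_class h I {W1, W2, W4}" and "\<beta> \<in> GH_class h J {W1, W2, W4}"
    and "\<gamma> \<in> GH_class h K {W1, W3, W4}" and "DIM('v) > 2"
  shows "\<gamma> \<in> GH_class h K {W3, W4}"
proof -
  obtain \<phi> where \<phi>: "\<phi> 0 = 0" "\<And>x y z. nij K \<gamma> x y z = h x (J y) * \<phi> z - h x (I y) * \<phi> (K z)
    - (h x (J z) * \<phi> y - h x (I z) * \<phi> (K y))" using nij_\<gamma>_124[OF assms(1,2)] by blast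
  have "\<phi> x = 0" for x
  proof -
    have "nij K \<gamma> x x (J x) = 0" using K.class_134D[OF assms(3), of x x "J x"] by simp
    then have "h x x * \<phi> x = 0" by (simp add: \<phi>(2) q_simps)
    then show ?thesis using \<phi>(1) by (auto simp: I.eq_0_iff)
  qed
  then show ?thesis by (intro class_34I_nij assms(4)) (simp add: \<phi>(2))
qed

text \<open>Dimension above four supplies a nonzero \<open>y\<close> orthogonal to the quaternionic
  line of \<open>z\<close>. The cyclic sum at \<open>y, J y, z\<close> then reduces to a nonzero
  multiple of \<open>h y y * \<phi> z\<close>.\<close>

lemma class_124_imp_W2:
  assumes "\<alpha> \<in> GH_class h I {W1, W2, W4}" and "\<beta> \<in> GH_class h J {W1, W2, W4}"
    and "\<gamma> \<in> GH_class h K {W2, W3, W4}" and "DIM('v) > 4"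
  shows "\<gamma> \<in> GH_class h K {W3, W4}"
proof -
  obtain \<phi> where \<phi>: "\<phi> 0 = 0" "\<And>x y z. nij K \<gamma> x y z = h x (J y) * \<phi> z - h x (I y) * \<phi> (K z)
    - (h x (J z) * \<phi> y - h x (I z) * \<phi> (K y))" using nij_\<gamma>_124[OF assms(1,2)] by blast
  have "\<phi> z = 0" for z
  proof -
    obtain y where "y \<noteq> 0" and y: "h y z = 0" "h y (I z) = 0" "h y (J z) = 0" "h y (K z) = 0"
      using orthogonal_vector_exists_quaternion[OF assms(4)] by blast
    have "h z y = 0" "h z (I y) = 0" "h z (J y) = 0" "h z (K y) = 0"
      using y I.sym[of z y] I.sym[of z "I y"] I.sym[of z "J y"] I.sym[of z "K y"]
      by (simp_all add: q_simps)
    then have "h y y * \<phi> z = 0"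
      using K.class_234D[OF assms(3), of y "J y" z] y by (auto simp: \<phi>(2) q_simps)
    then show ?thesis using \<open>y \<noteq> 0\<close> by (simp add: I.eq_0_iff)
  qed
  then show ?thesis using assms(4) by (intro class_34I_nij) (simp_all add: \<phi>(2))
qed

end

section \<open>Quaternionic dimension two\<close>

context hyperhermitian
begin

text \<open>Distinctness is recorded so that a trace over this set can be written out as eight
  terms.\<close>

lemma quaternionic_basis:
  assumes dim: "DIM('v) = 8" and x: "h x x = 1" and y: "h y y = 1"
    and ortho: "h y x = 0" "h y (I x) = 0" "h y (J x) = 0" "h y (K x) = 0"
  shows "orthonormal_basis_for h {x, I x, J x, K x, y, I y, J y, K y}"
    and "distinct [x, I x, J x, K x, y, I y, J y, K y]"
proof -
  let ?B = "[x, I x, J x, K x, y, I y, J y, K y]"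
  have ortho': "h x y = 0" "h x (I y) = 0" "h x (J y) = 0" "h x (K y) = 0"
    using ortho I.sym[of x y] I.sym[of x "I y"] I.sym[of x "J y"] I.sym[of x "K y"]
    by (simp_all add: q_simps)
  have o: "h (?B ! i) (?B ! j) = (if i = j then 1 else 0)" if "i < 8" "j < 8" for i j
  proof -
    have "i \<in> {0, 1, 2, 3, 4, 5, 6, 7}" "j \<in> {0, 1, 2, 3, 4, 5, 6, 7}" using that by auto
    then show ?thesis
      by (elim insertE emptyE) (simp_all add: q_simps x y ortho ortho')
  qed
  have length_B: "length ?B = 8" by simp
  show d: "distinct ?B"
    unfolding distinct_conv_nth
  proof (intro allI impI)
    fix i j assume "i < length ?B" "j < length ?B" "i \<noteq> j"
    then show "?B ! i \<noteq> ?B ! j" using o[of i j] o[of j j] by auto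
  qed
  have "orthonormal_basis_for h (set ?B)"
  proof (rule I.orthonormal_basis_if_card)
    fix e f assume "e \<in> set ?B" "f \<in> set ?B"
    then obtain i j where "i < 8" "j < 8" and ef: "e = ?B ! i" "f = ?B ! j"
      by (metis in_set_conv_nth length_B)
    moreover have "e = f \<longleftrightarrow> i = j"
      unfolding ef using d \<open>i < 8\<close> \<open>j < 8\<close> by (intro nth_eq_iff_index_eq) auto
    ultimately show "h e f = (if e = f then 1 else 0)" using o by simp
  qed (use distinct_card[OF d] dim in simp_all)
  then show "orthonormal_basis_for h {x, I x, J x, K x, y, I y, J y, K y}" by simp
qed

text \<open>
  A totally skew \<open>b\<close> of type (3,0) + (0,3) in quaternionic dimension two is given by a covector,
  which the contraction with \<open>\<omega>\<^sub>I\<close> recovers.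
\<close>

lemma zero_if_contraction_zero:
  assumes dim: "DIM('v) = 8" and b: "b \<in> GH_space K"
    and alt: "\<And>x y z. b y x z = - b x y z"
    and contr: "\<And>x y z. h x x = 1 \<Longrightarrow> h y y = 1 \<Longrightarrow> h y x = 0 \<Longrightarrow> h y (I x) = 0 \<Longrightarrow>
      h y (J x) = 0 \<Longrightarrow> h y (K x) = 0 \<Longrightarrow> b x (I x) z + b y (I y) z = 0"
  shows "b x y z = 0"
proof -
  note l = GH_spaceD[OF b] and m = GH_space_minus[OF b]
  have K: "b u (K v) w = b u v (K w)" for u v w
    using l(5)[of u v "K w"] by (simp add: K.square m)
  have cyc: "b u v w = b v w u" for u v w
    using alt[of u v w] l(4)[of v u w] by simp
  have self: "b w u u = 0" "b u w u = 0" for u w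
    using l(4)[of w u u] cyc[of w u u] cyc[of u w u] by simp_all
  have quat: "b u (I u) u = 0" "b u (I u) (I u) = 0" "b u (I u) (J u) = 0" "b u (I u) (K u) = 0" for u
  proof -
    show "b u (I u) u = 0" "b u (I u) (I u) = 0" by (rule self)+
    show "b u (I u) (J u) = 0"
      using K[of u "I u" "I u"] l(4)[of u "I u" "J u"] by (simp add: products)
    show "b u (I u) (K u) = 0"
      using K[of u "I u" u] l(4)[of u "J u" u] self by (simp add: products)
  qed
  \<comment> \<open>Take a unit \<open>v\<close> orthogonal to the quaternionic line of
    \<open>u\<close>. On the line of \<open>u\<close> the form vanishes by \<open>quat\<close>; on
    that of \<open>v\<close>, \<open>contr\<close> replaces it by \<open>- b v (I v)\<close>, to
    which \<open>quat\<close> applies again.\<close>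
  have unit: "b u (I u) w = 0" if u: "h u u = 1" for u w
  proof -
    have "DIM('v) > 4" using dim by simp
    then obtain v0 where v0: "v0 \<noteq> 0" "h v0 u = 0" "h v0 (I u) = 0" "h v0 (J u) = 0" "h v0 (K u) = 0"
      by (rule orthogonal_vector_exists_quaternion)
    define v where "v = (1 / sqrt (h v0 v0)) *\<^sub>R v0"
    have v: "h v v = 1" "h v u = 0" "h v (I u) = 0" "h v (J u) = 0" "h v (K u) = 0"
      using v0 I.pos[OF v0(1)] by (simp_all add: v_def)
    let ?B = "{u, I u, J u, K u, v, I v, J v, K v}"
    have "b u (I u) e = 0" if "e \<in> ?B" for e
      using that quat[of u] quat[of v] contr[OF u v, of e] by auto
    moreover have "w \<in> span ?B"
      using quaternionic_basis(1)[OF dim u v] by (simp add: orthonormal_basis_for_def)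
    ultimately show ?thesis
      using linear_eq_on_span[OF l(3) module_hom_zero, of ?B u "I u" w] by simp
  qed
  have xIx: "b u (I u) w = 0" for u w
  proof (cases "u = 0")
    case True
    then show ?thesis by (simp add: linear_0[OF l(1)])
  next
    case False
    then have p: "h u u > 0" by (rule I.pos)
    define c where "c = 1 / sqrt (h u u)"
    have c: "c \<noteq> 0" "h (c *\<^sub>R u) (c *\<^sub>R u) = 1" using p by (simp_all add: c_def)
    from unit[OF c(2), of w] c(1) show ?thesis
      by (simp add: I.A_simps linear_cmul[OF l(1)] linear_cmul[OF l(2)])
  qed
  \<comment> \<open>Polarising \<open>xIx\<close> lets \<open>I\<close> pass between arguments
    without a sign, as \<open>K\<close> does.\<close>
  have I: "b (I u) v w = b u (I v) w" for u v w
  proof -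
    have "b u (I v) w + b v (I u) w = 0"
      using xIx[of "u + v" w] xIx[of u w] xIx[of v w]
      by (simp add: I.A_simps linear_add[OF l(1)] linear_add[OF l(2)])
    then show ?thesis using alt[of v "I u" w] by simp
  qed
  have I': "b u (I v) w = b u v (I w)" for u v w
    using I[of v w u] cyc[of u "I v" w] cyc[of u v "I w"] by simp
  \<comment> \<open>Moving J = KI past an argument reverses the order of the factors, and IK =
    -J.\<close>
  have J: "b u (J v) w = - b u v (J w)" for u v w
    using K[of u "I v" w] I'[of u v "K w"] by (simp add: products m)
  \<comment> \<open>Carrying \<open>J\<close> once around the three arguments multiplies the value
    by (-1)^3.\<close>
  have "b u (J v) w = 0" for u v w
    using J[of u v w] J[of v w u] J[of w u v] cyc[of "J u" v w] cyc[of v "J w" u] cyc[of "J w" u v]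
      cyc[of w "J u" v] cyc[of w u "J v"]
    by simp
  from this[of x "J y" z] show ?thesis by (simp add: J.square m)
qed

end

context hyperhermitian_torsion
begin

text \<open>Over one quaternionic line the contraction of \<open>nij K \<gamma>\<close> with
  \<open>\<omega>\<^sub>I\<close> becomes partial traces of \<open>\<alpha>\<close> and
  \<open>\<beta>\<close>; two orthogonal lines in dimension eight yield the full traces, which
  vanish by \<open>class_123_trace\<close>.\<close>

lemma nij_\<gamma>_contraction:
  "nij K \<gamma> x (I x) z + nij K \<gamma> (I x) (I (I x)) z + nij K \<gamma> (J x) (I (J x)) z + nij K \<gamma> (K x) (I (K x)) z =
   2 * (\<beta> x x z + \<beta> (I x) (I x) z + \<beta> (J x) (J x) z + \<beta> (K x) (K x) z
      + \<alpha> x x (K z) + \<alpha> (I x) (I x) (K z) + \<alpha> (J x) (J x) (K z) + \<alpha> (K x) (K x) (K z))"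
  by (simp add: nij_def \<alpha>_eq \<beta>_eq \<gamma>_eq q_simps \<xi>_minus field_simps)

lemma class_123_imp:
  assumes "\<alpha> \<in> GH_class h I {W1, W2, W3}" and "\<beta> \<in> GH_class h J {W1, W2, W3}"
    and \<gamma>134: "\<gamma> \<in> GH_class h K {W1, W3, W4}" and dim: "DIM('v) = 8"
  shows "\<gamma> \<in> GH_class h K {W3, W4}"
proof (rule class_34I_nij)
  fix x y z
  have N: "nij K \<gamma> \<in> GH_space K" by (rule K.nij_in_GH_space[OF \<gamma>])
  note m = GH_space_minus[OF N] and alt = K.class_134D[OF \<gamma>134]
  have K: "nij K \<gamma> (K u) v w = nij K \<gamma> u (K v) w" for u v w
    by (simp add: nij_def K.square GH_space_minus[OF \<gamma>])
  \<comment> \<open>Skewness and the passage of \<open>K\<close> between the first two arguments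
    make the four summands equal.\<close>
  have four: "nij K \<gamma> u (I u) w + nij K \<gamma> (I u) (I (I u)) w + nij K \<gamma> (J u) (I (J u)) w
      + nij K \<gamma> (K u) (I (K u)) w = 4 * nij K \<gamma> u (I u) w" for u w
    using alt[of u "I u" w] K[of u "J u" w] K[of "I u" "K u" w] alt[of "J u" "K u" w]
    by (simp add: q_simps m)
  show "nij K \<gamma> x y z = 0"
  proof (rule zero_if_contraction_zero[OF dim N alt])
    fix x y z
    assume "h x x = 1" "h y y = 1" "h y x = 0" "h y (I x) = 0" "h y (J x) = 0" "h y (K x) = 0"
    note B = quaternionic_basis[OF dim this]
    have "\<beta> x x z + \<beta> (I x) (I x) z + \<beta> (J x) (J x) z + \<beta> (K x) (K x) z
      + \<beta> y y z + \<beta> (I y) (I y) z + \<beta> (J y) (J y) z + \<beta> (K y) (K y) z = 0"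
      using J.class_123_trace[OF assms(2) B(1), of z] B(2) by simp
    moreover have "\<alpha> x x (K z) + \<alpha> (I x) (I x) (K z) + \<alpha> (J x) (J x) (K z) + \<alpha> (K x) (K x) (K z)
      + \<alpha> y y (K z) + \<alpha> (I y) (I y) (K z) + \<alpha> (J y) (J y) (K z) + \<alpha> (K y) (K y) (K z) = 0"
      using I.class_123_trace[OF assms(1) B(1), of "K z"] B(2) by simp
    ultimately show "nij K \<gamma> x (I x) z + nij K \<gamma> y (I y) z = 0"
      using nij_\<gamma>_contraction[of x z] nij_\<gamma>_contraction[of y z] four[of x z] four[of y z] by simp
  qed
qed (use dim in simp)

end

section \<open>Covariant derivatives of the fundamental forms\<close>

text \<open>A product rule from differentiability of \<open>F\<close> at each fixed vector only:
  linearity of \<open>F x\<close> and expansion in \<open>Basis\<close> reduce it to finitely many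
  ordinary products.\<close>

lemma has_derivative_linear_family:
  fixes F :: "'x::real_normed_vector \<Rightarrow> 'v::euclidean_space \<Rightarrow> 'w::real_normed_vector"
  assumes S: "open S" "x \<in> S" and lin: "\<And>x. x \<in> S \<Longrightarrow> linear (F x)"
    and F: "\<And>v. ((\<lambda>x. F x v) has_derivative (\<lambda>u. F' u v)) (at x)"
    and y: "(y has_derivative y') (at x)"
  shows "((\<lambda>x. F x (y x)) has_derivative (\<lambda>u. F' u (y x) + F x (y' u))) (at x)"
proof -
  have expand: "F x v = (\<Sum>b\<in>Basis. (v \<bullet> b) *\<^sub>R F x b)" if "x \<in> S" for x v
  proof -
    have "F x v = F x (\<Sum>b\<in>Basis. (v \<bullet> b) *\<^sub>R b)" by (simp add: euclidean_representation)
    then show ?thesis by (simp add: linear_sum[OF lin[OF that]] linear_cmul[OF lin[OF that]])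
  qed
  \<comment> \<open>Linearity of \<open>F' u\<close> is not assumed; it follows from uniqueness of
    derivatives.\<close>
  have F'_expand: "F' u v = (\<Sum>b\<in>Basis. (v \<bullet> b) *\<^sub>R F' u b)" for u v
  proof -
    have "((\<lambda>x. \<Sum>b\<in>Basis. (v \<bullet> b) *\<^sub>R F x b) has_derivative (\<lambda>u. \<Sum>b\<in>Basis. (v \<bullet> b) *\<^sub>R F' u b)) (at x)"
      by (intro has_derivative_sum has_derivative_scaleR_right F)
    then have "((\<lambda>x. F x v) has_derivative (\<lambda>u. \<Sum>b\<in>Basis. (v \<bullet> b) *\<^sub>R F' u b)) (at x)"
      by (rule has_derivative_transform_within_open[OF _ S]) (simp add: expand[symmetric])
    from has_derivative_unique[OF this F[of v]] show ?thesis by metis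
  qed
  have "((\<lambda>x. \<Sum>b\<in>Basis. (y x \<bullet> b) *\<^sub>R F x b) has_derivative
      (\<lambda>u. \<Sum>b\<in>Basis. (y x \<bullet> b) *\<^sub>R F' u b + (y' u \<bullet> b) *\<^sub>R F x b)) (at x)"
    by (intro has_derivative_sum has_derivative_scaleR has_derivative_inner_left F y)
  then have "((\<lambda>x. F x (y x)) has_derivative
      (\<lambda>u. \<Sum>b\<in>Basis. (y x \<bullet> b) *\<^sub>R F' u b + (y' u \<bullet> b) *\<^sub>R F x b)) (at x)"
    by (rule has_derivative_transform_within_open[OF _ S]) (simp add: expand[symmetric])
  also have "(\<lambda>u. \<Sum>b\<in>Basis. (y x \<bullet> b) *\<^sub>R F' u b + (y' u \<bullet> b) *\<^sub>R F x b) =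
      (\<lambda>u. F' u (y x) + F x (y' u))"
    by (simp only: sum.distrib expand[OF S(2), symmetric] F'_expand[symmetric])
  finally show ?thesis .
qed

lemma chart_inv_chart_map:
  assumes "smooth_manifold X \<A>" and "c \<in> \<A>" and "p \<in> chart_dom c"
  shows "chart_inv c (chart_map c p) = p"
proof -
  have op: "openin X (chart_dom c)" and
    hom: "homeomorphic_map (subtopology X (chart_dom c)) (top_of_set (chart_map c ` chart_dom c)) (chart_map c)"
    using assms by (auto simp: smooth_manifold_def)
  then have "inj_on (chart_map c) (chart_dom c)"
    using homeomorphic_imp_injective_map[OF hom] openin_subset[OF op] by (simp add: Int_absorb1)
  then show ?thesis using assms(3) by (simp add: chart_inv_def)
qed

lemma smooth_on_has_derivative:
  assumes "smooth_on f S" and "x \<in> S"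
  shows "(f has_derivative frechet_derivative f (at x)) (at x)"
proof -
  have "Ck_on (Suc 0) f S" using assms(1) unfolding smooth_on_def by blast
  then show ?thesis using assms(2) by (simp add: frechet_derivative_works[symmetric])
qed

text \<open>A coordinate derivative with \<open>w\<close> constant in the chart. It is not tensorial
  by itself; the Christoffel terms in \<open>nabla_fundamental_form\<close> complete it to
  \<nabla>E.\<close>

definition endo_deriv :: "('a, 'v::euclidean_space) chart \<Rightarrow> ('a, 'v) endo_field \<Rightarrow> 'a \<Rightarrow> 'v \<Rightarrow> 'v \<Rightarrow> 'v" where
  "endo_deriv c E p u w = frechet_derivative (\<lambda>x. E c (chart_inv c x) w) (at (chart_map c p)) u"

lemma endo_deriv:
  assumes "endomorphism_field \<A> E" and "c \<in> \<A>" and "p \<in> chart_dom c"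
  shows "((\<lambda>x. E c (chart_inv c x) w) has_derivative (\<lambda>u. endo_deriv c E p u w)) (at (chart_map c p))"
  unfolding endo_deriv_def
  by (rule smooth_on_has_derivative[of _ "chart_map c ` chart_dom c"])
    (use assms in \<open>auto simp: endomorphism_field_def\<close>)

lemma chart_inv_in_dom: "x \<in> chart_map c ` chart_dom c \<Longrightarrow> chart_inv c x \<in> chart_dom c"
  by (simp add: chart_inv_def inv_into_into)

text \<open>The scalar \<open>s\<close> lets one Leibniz rule serve both K = IJ and K = -JI.\<close>

lemma endo_deriv_compose:
  assumes M: "smooth_manifold X \<A>" and E: "endomorphism_field \<A> E" and F: "endomorphism_field \<A> F"
    and G: "endomorphism_field \<A> G" and c: "c \<in> \<A>" and p: "p \<in> chart_dom c"
    and comp: "\<And>q v. q \<in> chart_dom c \<Longrightarrow> G c q v = s *\<^sub>R E c q (F c q v)"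
  shows "endo_deriv c G p u w = s *\<^sub>R (endo_deriv c E p u (F c p w) + E c p (endo_deriv c F p u w))"
proof -
  let ?S = "chart_map c ` chart_dom c" and ?x = "chart_map c p"
  have S: "open ?S" "?x \<in> ?S" using M c p by (auto simp: smooth_manifold_def)
  have linE: "linear (E c q)" if "q \<in> chart_dom c" for q
    using E c that by (auto simp: endomorphism_field_def)
  have "((\<lambda>x. E c (chart_inv c x) (F c (chart_inv c x) w)) has_derivative
    (\<lambda>u. endo_deriv c E p u (F c (chart_inv c ?x) w) + E c (chart_inv c ?x) (endo_deriv c F p u w))) (at ?x)"
    by (rule has_derivative_linear_family[OF S _ endo_deriv[OF E c p] endo_deriv[OF F c p]])
      (intro linE chart_inv_in_dom)
  from has_derivative_scaleR_right[OF this, of s]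
  have "((\<lambda>x. s *\<^sub>R E c (chart_inv c x) (F c (chart_inv c x) w)) has_derivative
    (\<lambda>u. s *\<^sub>R (endo_deriv c E p u (F c p w) + E c p (endo_deriv c F p u w)))) (at ?x)"
    by (simp only: chart_inv_chart_map[OF M c p])
  then have "((\<lambda>x. G c (chart_inv c x) w) has_derivative
    (\<lambda>u. s *\<^sub>R (endo_deriv c E p u (F c p w) + E c p (endo_deriv c F p u w)))) (at ?x)"
    by (rule has_derivative_transform_within_open[OF _ S]) (simp only: comp[OF chart_inv_in_dom])
  from has_derivative_unique[OF this endo_deriv[OF G c p]] show ?thesis by metis
qed

text \<open>The second argument of \<open>g c p\<close> on the right is
  \<open>(\<nabla>\<^sub>u E) w\<close>. Metric compatibility turns the derivative of
  \<open>g\<close> into Christoffel terms, and the one acting on \<open>v\<close> cancels.\<close>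

lemma nabla_fundamental_form:
  assumes M: "smooth_manifold X \<A>" and g: "riemannian_metric \<A> g" and E: "endomorphism_field \<A> E"
    and c: "c \<in> \<A>" and p: "p \<in> chart_dom c"
  shows "nabla g (fundamental_form g E) c p u v w = g c p v
    (endo_deriv c E p u w + levi_civita g c p u (E c p w) - E c p (levi_civita g c p u w))"
proof -
  let ?S = "chart_map c ` chart_dom c" and ?x = "chart_map c p"
  have S: "open ?S" "?x \<in> ?S" using M c p by (auto simp: smooth_manifold_def)
  have bil: "bilinear (g c q)" if "q \<in> chart_dom c" for q
    using g c that by (auto simp: riemannian_metric_def)
  have ling: "linear (g c q v)" if "q \<in> chart_dom c" for q
    using bil[OF that] by (simp add: bilinear_def)
  have D: "((\<lambda>x. g c (chart_inv c x) v w) has_derivative (chart_deriv c (\<lambda>q. g c q v w) p)) (at ?x)" for w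
    unfolding chart_deriv_def o_def
    by (rule smooth_on_has_derivative[of _ ?S]) (use g c p in \<open>auto simp: riemannian_metric_def\<close>)
  have "((\<lambda>x. g c (chart_inv c x) v (E c (chart_inv c x) w)) has_derivative
    (\<lambda>u. chart_deriv c (\<lambda>q. g c q v (E c (chart_inv c ?x) w)) p u
      + g c (chart_inv c ?x) v (endo_deriv c E p u w))) (at ?x)"
    by (rule has_derivative_linear_family[OF S _ D endo_deriv[OF E c p]])
      (intro ling chart_inv_in_dom)
  then have "((\<lambda>q. g c q v (E c q w)) \<circ> chart_inv c has_derivative
    (\<lambda>u. chart_deriv c (\<lambda>q. g c q v (E c p w)) p u + g c p v (endo_deriv c E p u w))) (at ?x)"
    by (simp add: o_def chart_inv_chart_map[OF M c p])
  from frechet_derivative_at[OF this] have "chart_deriv c (\<lambda>q. g c q v (E c q w)) p u =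
    chart_deriv c (\<lambda>q. g c q v (E c p w)) p u + g c p v (endo_deriv c E p u w)"
    by (subst chart_deriv_def) (simp only: fun_eq_iff)
  also have "chart_deriv c (\<lambda>q. g c q v (E c p w)) p u =
    g c p (levi_civita g c p u v) (E c p w) + g c p v (levi_civita g c p u (E c p w))"
    using is_levi_civita_levi_civita[OF M g c p] unfolding is_levi_civita_def by blast
  finally show ?thesis
    using bil[OF p] by (simp add: nabla_def fundamental_form_def bilinear_radd bilinear_rsub)
qed

text \<open>The two formulas for \<nabla>K come from the Leibniz rule for IJ and -JI, with the outer
  \<open>I\<close> or \<open>J\<close> moved across the metric by skewness. The hypotheses
  \<open>\<alpha>\<close> and \<open>\<beta>\<close> are later supplied by the class assumptions on
  \<open>I\<close> and \<open>J\<close>.\<close>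

lemma almost_hyper_hermitian_torsion:
  assumes M: "almost_hyper_hermitian X \<A> g I J K" and c: "c \<in> \<A>" and p: "p \<in> chart_dom c"
    and \<alpha>: "nabla g (fundamental_form g I) c p \<in> GH_space (I c p)"
    and \<beta>: "nabla g (fundamental_form g J) c p \<in> GH_space (J c p)"
  shows "hyperhermitian_torsion (g c p) (I c p) (J c p) (K c p)
    (nabla g (fundamental_form g I) c p) (nabla g (fundamental_form g J) c p)
    (nabla g (fundamental_form g K) c p)"
proof -
  have X: "smooth_manifold X \<A>" and g: "riemannian_metric \<A> g"
    and E: "endomorphism_field \<A> I" "endomorphism_field \<A> J" "endomorphism_field \<A> K"
    using M by (auto simp: almost_hyper_hermitian_def)
  have alg: "I c q (I c q u) = - u" "J c q (J c q u) = - u" "K c q u = I c q (J c q u)"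
    "K c q u = - J c q (I c q u)" "g c q (I c q u) (I c q v) = g c q u v"
    "g c q (J c q u) (J c q v) = g c q u v" "g c q (K c q u) (K c q v) = g c q u v"
    if "q \<in> chart_dom c" for q u v
    using M c that unfolding almost_hyper_hermitian_def by blast+
  have lin: "linear (I c q)" "linear (J c q)" "linear (K c q)" if "q \<in> chart_dom c" for q
    using E c that by (auto simp: endomorphism_field_def)
  have K2: "K c p (K c p u) = - u" for u
    using alg(1,2)[OF p] alg(3)[OF p, of "K c p u"] alg(4)[OF p, of u] linear_neg[OF lin(1)[OF p]]
      linear_neg[OF lin(2)[OF p]] by simp
  have gp: "bilinear (g c p)" "g c p u v = g c p v u" "u \<noteq> 0 \<Longrightarrow> g c p u u > 0" for u v
    using g c p unfolding riemannian_metric_def by blast+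
  interpret hyperhermitian "g c p" "I c p" "J c p" "K c p"
    by unfold_locales (fact gp alg[OF p] lin[OF p, THEN linear_add] lin[OF p, THEN linear_cmul] K2)+
  have IJ: "endo_deriv c K p u w = endo_deriv c I p u (J c p w) + I c p (endo_deriv c J p u w)"
    and JI: "endo_deriv c K p u w = - (endo_deriv c J p u (I c p w) + J c p (endo_deriv c I p u w))" for u w
    using endo_deriv_compose[OF X E(1,2,3) c p, of 1] endo_deriv_compose[OF X E(2,1,3) c p, of "- 1"]
      alg(3,4) by simp_all
  have \<Gamma>: "bilinear (levi_civita g c p)"
    using is_levi_civita_levi_civita[OF X g c p] by (simp add: is_levi_civita_def)
  show ?thesis
  proof
    fix u v w
    note n = nabla_fundamental_form[OF X g E(1) c p] nabla_fundamental_form[OF X g E(2) c p]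
      nabla_fundamental_form[OF X g E(3) c p]
    show "nabla g (fundamental_form g K) c p u v w = nabla g (fundamental_form g I) c p u v (J c p w)
      - nabla g (fundamental_form g J) c p u (I c p v) w"
      by (simp add: n IJ q_simps)
    show "nabla g (fundamental_form g K) c p u v w = nabla g (fundamental_form g I) c p u (J c p v) w
      - nabla g (fundamental_form g J) c p u v (I c p w)"
      by (simp add: n JI q_simps bilinear_rneg[OF \<Gamma>])
  qed (fact \<alpha> \<beta>)+
qed

theorem theorem4p1:
  fixes X :: "'a topology"
    and \<A> :: "('a, 'v::euclidean_space) chart set"
    and g :: "('a, 'v) bilinear_field"
    and I J K :: "('a, 'v) endo_field"
    and n :: nat
  assumes "n \<ge> 2"
    and "DIM('v) = 4 * n"
    and "almost_hyper_hermitian X \<A> g I J K"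
  shows
    "(\<forall>C. nabla_form_in \<A> g I {W3, W4} \<and> nabla_form_in \<A> g J C \<longrightarrow> nabla_form_in \<A> g K C)
     \<and>
     (\<forall>C\<in>{W1, W2}.
        nabla_form_in \<A> g I {C, W3, W4} \<and> nabla_form_in \<A> g J {C, W3, W4} \<longrightarrow>
        nabla_form_in \<A> g K {C, W3, W4})
     \<and>
     (nabla_form_in \<A> g I {W1, W2} \<and> nabla_form_in \<A> g J {W1, W2} \<longrightarrow>
        nabla_form_in \<A> g K {W3, W4})
     \<and>
     (\<forall>C\<in>{W1, W2}.
        nabla_form_in \<A> g I {W1, W2, W4} \<and> nabla_form_in \<A> g J {W1, W2, W4} \<and>
        nabla_form_in \<A> g K {C, W3, W4} \<longrightarrow>
        nabla_form_in \<A> g K {W3, W4})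
     \<and>
     (DIM('v) = 8 \<longrightarrow>
        nabla_form_in \<A> g I {W1, W2, W3} \<and> nabla_form_in \<A> g J {W1, W2, W3} \<and>
        nabla_form_in \<A> g K {W1, W3, W4} \<longrightarrow>
        nabla_form_in \<A> g K {W3, W4})"
proof -
  have torsion: "hyperhermitian_torsion (g c p) (I c p) (J c p) (K c p)
      (nabla g (fundamental_form g I) c p) (nabla g (fundamental_form g J) c p)
      (nabla g (fundamental_form g K) c p)"
    if "nabla_form_in \<A> g I S" "nabla_form_in \<A> g J T" "c \<in> \<A>" "p \<in> chart_dom c" for S T c p
    using that unfolding nabla_form_in_def
    by (intro almost_hyper_hermitian_torsion[OF assms(3)]) (blast intro: GH_class_subset[THEN subsetD])+
  have dim: "DIM('v) > 4" "DIM('v) > 2" using assms(1,2) by simp_all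
  have i: "nabla_form_in \<A> g K C" if "nabla_form_in \<A> g I {W3, W4}" "nabla_form_in \<A> g J C" for C
    using hyperhermitian_torsion.class_34_imp[OF torsion[OF that]] that
    by (simp add: nabla_form_in_def)
  have ii: "nabla_form_in \<A> g K {C, W3, W4}"
    if C: "C \<in> {W1, W2}" and "nabla_form_in \<A> g I {C, W3, W4}" "nabla_form_in \<A> g J {C, W3, W4}" for C
    using hyperhermitian_torsion.class_134_imp[OF torsion[OF that(2,3)]]
      hyperhermitian_torsion.class_234_imp[OF torsion[OF that(2,3)]] that dim(2)
    by (auto simp: nabla_form_in_def)
  have iii: "nabla_form_in \<A> g K {W3, W4}"
    if "nabla_form_in \<A> g I {W1, W2}" "nabla_form_in \<A> g J {W1, W2}"
    using hyperhermitian_torsion.class_12_imp[OF torsion[OF that]] that dim(2)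
    by (simp add: nabla_form_in_def)
  have iv: "nabla_form_in \<A> g K {W3, W4}"
    if C: "C \<in> {W1, W2}" and "nabla_form_in \<A> g I {W1, W2, W4}" "nabla_form_in \<A> g J {W1, W2, W4}"
      "nabla_form_in \<A> g K {C, W3, W4}" for C
    using hyperhermitian_torsion.class_124_imp_W1[OF torsion[OF that(2,3)]]
      hyperhermitian_torsion.class_124_imp_W2[OF torsion[OF that(2,3)]] that dim
    by (auto simp: nabla_form_in_def)
  have v: "nabla_form_in \<A> g K {W3, W4}"
    if "DIM('v) = 8" and "nabla_form_in \<A> g I {W1, W2, W3}" "nabla_form_in \<A> g J {W1, W2, W3}"
      "nabla_form_in \<A> g K {W1, W3, W4}"
    using hyperhermitian_torsion.class_123_imp[OF torsion[OF that(2,3)]] that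
    by (simp add: nabla_form_in_def)
  show ?thesis using i ii iii iv v by blast
qed

end
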